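(* Let $q$ be a fixed prime and $n\ge1$. Each of the following multiplicity-free sums of power sums is the Frobenius characteristic of a true representation of $S_n$, of dimension $n!$: (1) $\displaystyle\sum_{\lambda} p_\lambda$, over all $\lambda\vdash n$ all of whose parts are powers of $q$ (including $1=q^0$); if $q$ is odd, this representation is self-conjugate (isomorphic to its tensor product with the sign representation); (2) $\displaystyle\sum_{\lambda} p_\lambda$, over all $\lambda\vdash n$ with $\gcd(\lambda_i,q)=1$ for all $i$; (3) if $q$ is odd, $\displaystyle\sum_{\lambda} p_\lambda$, over all $\lambda\vdash n$ such that all $\lambda_i$ are odd and $\gcd(\lambda_i,q)=1$ for all $i$.
   Context: $p_\lambda=\prod_i p_{\lambda_i}$ denotes the power-sum symmetric function indexed by the partition $\lambda$. A symmetric function of degree $n$ is the Frobenius characteristic of a true representation of $S_n$ iff it is a nonnegative integer combination of Schur functions. *)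

theory Defs
  imports
    "HOL-Algebra.Sym_Groups"
    "HOL-Combinatorics.Orbits"
    "HOL-Computational_Algebra.Primes"
    "HOL-Library.Multiset"
    "HOL-Library.Poly_Mapping"
    "Jordan_Normal_Form.Matrix"
begin

section \<open>Formal power series in countably many variables\<close>

text \<open>
  Symmetric functions live in the ring of formal power series in the variables
  $x_0, x_1, x_2, \dots$. A monomial is a finitely supported exponent vector, and a series is an
  arbitrary family of coefficients indexed by monomials.
\<close>

typedef 'a mseries = "UNIV :: ((nat \<Rightarrow>\<^sub>0 nat) \<Rightarrow> 'a) set"
  morphisms mcoeff Abs_mseries
  by simp

setup_lifting type_definition_mseries

lemma mseries_eqI: "(\<And>m. mcoeff f m = mcoeff g m) \<Longrightarrow> f = g"
  by transfer auto

definition splits :: "(nat \<Rightarrow>\<^sub>0 nat) \<Rightarrow> ((nat \<Rightarrow>\<^sub>0 nat) \<times> (nat \<Rightarrow>\<^sub>0 nat)) set"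
  where "splits m = {(a, b). a + b = m}"

lemma finite_splits: "finite (splits m)"
proof -
  let ?K = "Poly_Mapping.keys m" and ?N = "sum (Poly_Mapping.lookup m) (Poly_Mapping.keys m) :: nat"
  let ?F = "{f. \<forall>i. (i \<in> ?K \<longrightarrow> f i \<in> {..?N}) \<and> (i \<notin> ?K \<longrightarrow> f i = (0::nat))}"
  have F: "finite ?F"
    by (rule finite_set_of_finite_funs) auto
  have sub: "Poly_Mapping.lookup a \<in> ?F" if "a + b = m" for a b
  proof -
    have le: "Poly_Mapping.lookup a i \<le> Poly_Mapping.lookup m i" for i
      using that by (auto simp: Poly_Mapping.lookup_add)
    have "Poly_Mapping.lookup a i \<le> ?N" if "i \<in> ?K" for i
      using le[of i] member_le_sum[of i ?K "Poly_Mapping.lookup m"] that by simp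
    moreover have "Poly_Mapping.lookup a i = 0" if "i \<notin> ?K" for i
      using le[of i] that by (simp add: in_keys_iff)
    ultimately show ?thesis by auto
  qed
  have "inj_on (\<lambda>(a, b). (Poly_Mapping.lookup a, Poly_Mapping.lookup b)) (splits m)"
    by (auto simp: inj_on_def Poly_Mapping.lookup_inject)
  moreover have "(\<lambda>(a, b). (Poly_Mapping.lookup a, Poly_Mapping.lookup b)) ` splits m \<subseteq> ?F \<times> ?F"
  proof
    fix z assume "z \<in> (\<lambda>(a, b). (Poly_Mapping.lookup a, Poly_Mapping.lookup b)) ` splits m"
    then obtain a b where z: "z = (Poly_Mapping.lookup a, Poly_Mapping.lookup b)" and ab: "a + b = m"
      by (auto simp: splits_def)
    have ba: "b + a = m"
      using ab by (simp add: add.commute)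
    show "z \<in> ?F \<times> ?F"
      unfolding z using sub[OF ab] sub[OF ba] by blast
  qed
  ultimately show ?thesis
    using F by (meson finite_SigmaI finite_imageD finite_subset)
qed

instantiation mseries :: (comm_ring_1) comm_ring_1
begin

lift_definition zero_mseries :: "'a mseries" is "\<lambda>_. 0" .
lift_definition one_mseries :: "'a mseries" is "\<lambda>m. if m = 0 then 1 else 0" .
lift_definition plus_mseries :: "'a mseries \<Rightarrow> 'a mseries \<Rightarrow> 'a mseries"
  is "\<lambda>f g m. f m + g m" .
lift_definition uminus_mseries :: "'a mseries \<Rightarrow> 'a mseries"
  is "\<lambda>f m. - f m" .
lift_definition minus_mseries :: "'a mseries \<Rightarrow> 'a mseries \<Rightarrow> 'a mseries"
  is "\<lambda>f g m. f m - g m" .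
lift_definition times_mseries :: "'a mseries \<Rightarrow> 'a mseries \<Rightarrow> 'a mseries"
  is "\<lambda>f g m. \<Sum>(a, b)\<in>splits m. f a * g b" .

instance
proof
  fix f g h :: "'a mseries"
  show "f * g * h = f * (g * h)"
  proof (transfer, rule ext)
    fix f g h :: "(nat \<Rightarrow>\<^sub>0 nat) \<Rightarrow> 'a" and m
    have "(\<Sum>(a, b)\<in>splits m. (\<Sum>(c, d)\<in>splits a. f c * g d) * h b)
        = (\<Sum>z\<in>Sigma (splits m) (\<lambda>(a, b). splits a).
             case z of ((a, b), (c, d)) \<Rightarrow> f c * g d * h b)"
      by (subst sum.Sigma[symmetric])
         (auto simp: finite_splits sum_distrib_right case_prod_beta intro!: sum.cong)
    also have "\<dots> = (\<Sum>z\<in>Sigma (splits m) (\<lambda>(a, b). splits b).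
             case z of ((a, b), (c, d)) \<Rightarrow> f a * (g c * h d))"
      by (rule sum.reindex_bij_witness
            [where i = "\<lambda>((a, b), (c, d)). ((a + c, d), (a, c))"
               and j = "\<lambda>((a, b), (c, d)). ((c, d + b), (d, b))"])
         (auto simp: splits_def add.assoc mult.assoc)
    also have "\<dots> = (\<Sum>(a, b)\<in>splits m. f a * (\<Sum>(c, d)\<in>splits b. g c * h d))"
      by (subst sum.Sigma[symmetric])
         (auto simp: finite_splits sum_distrib_left case_prod_beta intro!: sum.cong)
    finally show "(\<Sum>(a, b)\<in>splits m. (\<Sum>(c, d)\<in>splits a. f c * g d) * h b)
        = (\<Sum>(a, b)\<in>splits m. f a * (\<Sum>(c, d)\<in>splits b. g c * h d))" .
  qed
  show "f * g = g * f"
  proof (transfer, rule ext)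
    fix f g :: "(nat \<Rightarrow>\<^sub>0 nat) \<Rightarrow> 'a" and m
    show "(\<Sum>(a, b)\<in>splits m. f a * g b) = (\<Sum>(a, b)\<in>splits m. g a * f b)"
      by (rule sum.reindex_bij_witness
            [where i = "\<lambda>(a, b). (b, a)" and j = "\<lambda>(a, b). (b, a)"])
         (auto simp: splits_def add.commute mult.commute)
  qed
  show "1 * f = f"
  proof (transfer, rule ext)
    fix f :: "(nat \<Rightarrow>\<^sub>0 nat) \<Rightarrow> 'a" and m
    have "(\<Sum>(a, b)\<in>splits m. (if a = 0 then 1 else 0) * f b)
        = (\<Sum>(a, b)\<in>{(0 :: nat \<Rightarrow>\<^sub>0 nat, m)}. (if a = 0 then 1 else 0) * f b)"
      by (rule sum.mono_neutral_right, rule finite_splits) (auto simp: splits_def split: if_splits)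
    then show "(\<Sum>(a, b)\<in>splits m. (if a = 0 then 1 else 0) * f b) = f m"
      by simp
  qed
  show "(f + g) * h = f * h + g * h"
    by transfer (auto simp: fun_eq_iff distrib_right sum.distrib case_prod_beta)
  show "(0::'a mseries) \<noteq> 1"
    by transfer (metis zero_neq_one)
qed (transfer; simp add: fun_eq_iff algebra_simps)+

end

lift_definition mscale :: "'a::comm_ring_1 \<Rightarrow> 'a mseries \<Rightarrow> 'a mseries"
  is "\<lambda>c f m. c * f m" .


section \<open>Partitions and power sums\<close>

definition partitions :: "nat \<Rightarrow> nat multiset set"
  where "partitions n = {\<mu>. 0 \<notin># \<mu> \<and> sum_mset \<mu> = n}"

lemma finite_partitions: "finite (partitions n)"
proof (rule finite_subset)
  have sz: "size \<mu> \<le> sum_mset \<mu>" if "0 \<notin># \<mu>" for \<mu> :: "nat multiset"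
    using that by (induction \<mu>) auto
  have "set_mset \<mu> \<subseteq> {..n}" if "\<mu> \<in> partitions n" for \<mu>
    using that by (auto simp: partitions_def dest: multi_member_split)
  then show "partitions n \<subseteq> (\<Union>k\<le>n. {\<mu>. set_mset \<mu> \<subseteq> {..n} \<and> size \<mu> = k})"
    using sz by (auto simp: partitions_def)
  show "finite (\<Union>k\<le>n. {\<mu>. set_mset \<mu> \<subseteq> {..n} \<and> size \<mu> = k})"
    using finite_multisets_of_size[of "{..n}"]
    unfolding multisets_of_size_def by blast
qed

text \<open>The power sum $p_k = \sum_i x_i^k$; only $k \ge 1$ is meaningful.\<close>

lift_definition power_sum :: "nat \<Rightarrow> 'a::comm_ring_1 mseries"
  is "\<lambda>k m. if \<exists>i. m = Poly_Mapping.single i k then 1 else 0" .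

definition power_sum_part :: "nat multiset \<Rightarrow> 'a::comm_ring_1 mseries"
  where "power_sum_part \<mu> = (\<Prod>k\<in>#\<mu>. power_sum k)"


section \<open>Complex representations and the Frobenius characteristic\<close>

abbreviation GL :: "nat \<Rightarrow> complex mat monoid"
  where "GL d \<equiv> units_of (ring_mat TYPE(complex) d ())"

definition complex_rep :: "('g, 'b) monoid_scheme \<Rightarrow> nat \<Rightarrow> ('g \<Rightarrow> complex mat) \<Rightarrow> bool"
  where "complex_rep G d \<rho> \<longleftrightarrow> \<rho> \<in> hom G (GL d)"

definition isomorphic_reps ::
    "('g, 'b) monoid_scheme \<Rightarrow> nat \<Rightarrow> ('g \<Rightarrow> complex mat) \<Rightarrow> ('g \<Rightarrow> complex mat) \<Rightarrow> bool"
  where "isomorphic_reps G d \<rho> \<rho>' \<longleftrightarrow>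
    (\<exists>T\<in>carrier (GL d). \<forall>g\<in>carrier G. T * \<rho> g = \<rho>' g * T)"

text \<open>
  The sign representation is one-dimensional, so tensoring with it multiplies each matrix by the
  sign of the permutation.
\<close>

definition sign_twist :: "((nat \<Rightarrow> nat) \<Rightarrow> complex mat) \<Rightarrow> (nat \<Rightarrow> nat) \<Rightarrow> complex mat"
  where "sign_twist \<rho> w = of_int (sign w) \<cdot>\<^sub>m \<rho> w"

definition self_conjugate :: "nat \<Rightarrow> nat \<Rightarrow> ((nat \<Rightarrow> nat) \<Rightarrow> complex mat) \<Rightarrow> bool"
  where "self_conjugate n d \<rho> \<longleftrightarrow> isomorphic_reps (sym_group n) d \<rho> (sign_twist \<rho>)"

definition mat_trace :: "'a::comm_monoid_add mat \<Rightarrow> 'a"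
  where "mat_trace A = (\<Sum>i<dim_row A. A $$ (i, i))"

text \<open>
  For a permutation of a finite set, \<open>orbit w x\<close> is the cycle through \<open>x\<close>, fixed points
  giving singletons.
\<close>

definition cycle_type :: "nat \<Rightarrow> (nat \<Rightarrow> nat) \<Rightarrow> nat multiset"
  where "cycle_type n w = image_mset card (mset_set (orbit w ` {1..n}))"

text \<open>$\mathrm{ch}(\rho) = \frac{1}{n!}\sum_{w\in S_n} \mathrm{tr}(\rho(w))\,p_{\mathrm{type}(w)}$\<close>

definition frobenius_char :: "nat \<Rightarrow> ((nat \<Rightarrow> nat) \<Rightarrow> complex mat) \<Rightarrow> complex mseries"
  where "frobenius_char n \<rho> =
    mscale (1 / fact n)
      (\<Sum>w\<in>carrier (sym_group n). mscale (mat_trace (\<rho> w)) (power_sum_part (cycle_type n w)))"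

end

theory Submission
  imports Defs "HOL-Number_Theory.Cong"
begin

text \<open>
  In all three cases the admissible part sizes are the divisors of \<open>M'\<close> in a coprime
  factorization \<open>n! = M * M'\<close>. Let $S_n$ act on the span of its own elements by conjugation, but
  twist the action: the centralizer of $g$ acts on the basis vector $e_g$ by the linear character
  that sends a $k$-cycle of $g$ to $\zeta_k = e^{2 \pi i M'/k}$. The trace of $w$ is then the sum of
  these characters over the centralizer of $w$. All summands are 1 if every cycle length of $w$
  divides \<open>M'\<close>. Otherwise $w$ has a cycle $h$ of length $k$ with $\zeta_k \neq 1$, and the sum
  over each coset $g, gh, \dots, gh^{k-1}$ is a multiple of the sum of all powers of $\zeta_k$.
  Hence the trace is the order of the centralizer or 0, which gives the multiplicity-free sum of
  power sums. If \<open>M'\<close> is odd, the trace vanishes at odd permutations, so the representation and its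
  sign twist have the same character.
\<close>

text \<open>The numerator in \<open>zeta k\<close> meets two demands: the \<open>M\<close>-th power
  is exp(2 pi i n!/k) = 1 for 0 < k \<le> n, and \<open>zeta k\<close> is 1 exactly when k divides
  \<open>M'\<close>. So if \<open>w ^^ M'\<close> is the identity, every centralizer character takes
  at w a value whose order divides both \<open>M\<close> and \<open>M'\<close>, hence the value 1.
  On one conjugacy class the action is induced from a character of a centralizer; it is written as a
  cocycle \<open>alpha\<close> on all of S_n, which needs no class representatives and makes
  multiplicativity a telescoping identity. The delicate point is the coset sum: g and g h^t have
  different cycles, so the summands are values of characters of different centralizers and must be
  computed one by one. Multiplicity one comes from orbit counting: the centralizer orders over a
  class add up to n!, which cancels the 1/n! of the characteristic. Self-conjugacy asks for an
  actual intertwining matrix; it is found by maximizing the rank of an intertwiner, in place of a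
  decomposition into irreducibles.\<close>

section \<open>Idempotent matrices and generalized inverses\<close>

lemma rank_factorization:
  fixes E :: "'i \<Rightarrow> 'i \<Rightarrow> 'a::field"
  assumes "finite A"
  obtains S :: "'i set" and X Y where "finite S"
    and "\<And>i j. i \<in> A \<Longrightarrow> j \<in> A \<Longrightarrow> E i j = (\<Sum>s\<in>S. X i s * Y s j)"
    and "\<And>c s. (\<And>i. i \<in> A \<Longrightarrow> (\<Sum>s\<in>S. X i s * c s) = 0) \<Longrightarrow> s \<in> S \<Longrightarrow> c s = 0"
    and "\<And>c s. (\<And>j. j \<in> A \<Longrightarrow> (\<Sum>s\<in>S. c s * Y s j) = 0) \<Longrightarrow> s \<in> S \<Longrightarrow> c s = 0"
proof -
  define fac where "fac S X Y \<longleftrightarrow> finite S \<and> (\<forall>i\<in>A. \<forall>j\<in>A. E i j = (\<Sum>s\<in>S. X i s * Y s j))"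
    for S :: "'i set" and X Y
  \<comment> \<open>The trivial factorization \<open>E\<close> times identity starts the
    minimization.\<close>
  have "fac A E (\<lambda>s j. if s = j then 1 else 0)"
    using assms by (auto simp: fac_def if_distrib cong: if_cong)
  then have "\<exists>S. \<exists>X Y. fac S X Y"
    by blast
  then obtain S where "\<exists>X Y. fac S X Y" and min: "\<And>S'. \<exists>X Y. fac S' X Y \<Longrightarrow> card S \<le> card S'"
    using ex_has_least_nat[of "\<lambda>S. \<exists>X Y. fac S X Y" _ card] by blast
  then obtain X Y where fac: "fac S X Y"
    by blast
  then have S: "finite S"
    and E: "\<And>i j. i \<in> A \<Longrightarrow> j \<in> A \<Longrightarrow> E i j = (\<Sum>s\<in>S. X i s * Y s j)"
    by (auto simp: fac_def)
  have smaller: False if "t \<in> S" "fac (S - {t}) X' Y'" for t X' Y'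
  proof -
    have "card S \<le> card (S - {t})"
      using min that(2) by blast
    then show False
      using S that(1) card_Diff1_less[of S t] by simp
  qed
  have split: "sum f S = f t + sum f (S - {t})" if "t \<in> S" for f :: "'i \<Rightarrow> 'a" and t
    using S that by (rule sum.remove)
  show thesis
  proof (rule that[OF S E])
    fix c t assume c: "\<And>i. i \<in> A \<Longrightarrow> (\<Sum>s\<in>S. X i s * c s) = 0" and t: "t \<in> S"
    show "c t = 0"
    proof (rule ccontr)
      assume ct: "c t \<noteq> 0"
      \<comment> \<open>Column \<open>t\<close> of \<open>X\<close> is a combination of the other
        columns; its coefficients are moved into the remaining rows of \<open>Y\<close>.\<close>
      have "fac (S - {t}) X (\<lambda>s j. Y s j - c s / c t * Y t j)"
        unfolding fac_def
      proof (intro conjI ballI)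
        fix i j assume i: "i \<in> A" and j: "j \<in> A"
        have "X i t = - (\<Sum>s\<in>S - {t}. X i s * c s) / c t"
          using c[OF i] ct unfolding split[OF t] nonzero_eq_divide_eq[OF ct] by (simp add: eq_neg_iff_add_eq_0)
        then show "E i j = (\<Sum>s\<in>S - {t}. X i s * (Y s j - c s / c t * Y t j))"
          unfolding E[OF i j] split[OF t]
          by (simp add: right_diff_distrib sum_subtractf sum_distrib_right sum_divide_distrib
              mult.assoc[symmetric] sum_negf)
      qed (use S in simp)
      then show False
        using smaller[OF t] by blast
    qed
  next
    fix c t assume c: "\<And>j. j \<in> A \<Longrightarrow> (\<Sum>s\<in>S. c s * Y s j) = 0" and t: "t \<in> S"
    show "c t = 0"
    proof (rule ccontr)
      assume ct: "c t \<noteq> 0"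
      have "fac (S - {t}) (\<lambda>i s. X i s - X i t * (c s / c t)) Y"
        unfolding fac_def
      proof (intro conjI ballI)
        fix i j assume i: "i \<in> A" and j: "j \<in> A"
        have "Y t j = - (\<Sum>s\<in>S - {t}. c s * Y s j) / c t"
          using c[OF j] ct unfolding split[OF t] nonzero_eq_divide_eq[OF ct]
          by (simp add: eq_neg_iff_add_eq_0 mult.commute)
        then show "E i j = (\<Sum>s\<in>S - {t}. (X i s - X i t * (c s / c t)) * Y s j)"
          unfolding E[OF i j] split[OF t]
          by (simp add: left_diff_distrib sum_subtractf sum_distrib_left sum_divide_distrib
              mult.assoc sum_negf)
      qed (use S in simp)
      then show False
        using smaller[OF t] by blast
    qed
  qed
qed

text \<open>With E = XY as above, XYXY = XY can be cancelled on both sides to YX = 1, and tr(XY) =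
  tr(YX) is the size of \<open>S\<close>. Size 0 makes the factorization an empty sum.\<close>

lemma trace_idempotent:
  fixes E :: "'i \<Rightarrow> 'i \<Rightarrow> 'a::field"
  assumes A: "finite A"
    and idem: "\<And>i j. i \<in> A \<Longrightarrow> j \<in> A \<Longrightarrow> (\<Sum>k\<in>A. E i k * E k j) = E i j"
  obtains r :: nat where "(\<Sum>i\<in>A. E i i) = of_nat r"
    and "r = 0 \<Longrightarrow> \<forall>i\<in>A. \<forall>j\<in>A. E i j = 0"
proof (rule rank_factorization[OF A, of E])
  fix S :: "'i set" and X Y
  assume S: "finite S"
    and E: "\<And>i j. i \<in> A \<Longrightarrow> j \<in> A \<Longrightarrow> E i j = (\<Sum>s\<in>S. X i s * Y s j)"
    and X: "\<And>c s. (\<And>i. i \<in> A \<Longrightarrow> (\<Sum>s\<in>S. X i s * c s) = 0) \<Longrightarrow> s \<in> S \<Longrightarrow> c s = 0"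
    and Y: "\<And>c s. (\<And>j. j \<in> A \<Longrightarrow> (\<Sum>s\<in>S. c s * Y s j) = 0) \<Longrightarrow> s \<in> S \<Longrightarrow> c s = 0"
  \<comment> \<open>\<open>Z\<close> is YX - 1; idempotence says X Z Y = 0.\<close>
  define Z where "Z s t = (\<Sum>i\<in>A. Y s i * X i t) - (if s = t then 1 else 0)" for s t
  have "(\<Sum>s\<in>S. X i s * (\<Sum>t\<in>S. Z s t * Y t j)) = 0" if i: "i \<in> A" and j: "j \<in> A" for i j
  proof -
    have "E i j = (\<Sum>k\<in>A. E i k * E k j)"
      using idem[OF i j] by (rule sym)
    also have "\<dots> = (\<Sum>k\<in>A. (\<Sum>s\<in>S. X i s * Y s k) * (\<Sum>t\<in>S. X k t * Y t j))"
    proof (rule sum.cong[OF refl])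
      fix k assume "k \<in> A"
      then show "E i k * E k j = (\<Sum>s\<in>S. X i s * Y s k) * (\<Sum>t\<in>S. X k t * Y t j)"
        using E[of i k] E[of k j] i j by metis
    qed
    also have "\<dots> = (\<Sum>k\<in>A. \<Sum>s\<in>S. \<Sum>t\<in>S. X i s * (Y s k * X k t * Y t j))"
      by (simp add: sum_product mult.assoc)
    also have "\<dots> = (\<Sum>s\<in>S. \<Sum>t\<in>S. \<Sum>k\<in>A. X i s * (Y s k * X k t * Y t j))"
      by (subst sum.swap, rule sum.cong[OF refl], rule sum.swap)
    also have "\<dots> = (\<Sum>s\<in>S. X i s * (\<Sum>t\<in>S. (\<Sum>k\<in>A. Y s k * X k t) * Y t j))"
      by (simp add: sum_distrib_left sum_distrib_right)
    finally have "E i j = (\<Sum>s\<in>S. X i s * (\<Sum>t\<in>S. (\<Sum>k\<in>A. Y s k * X k t) * Y t j))" .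
    moreover have "(\<Sum>t\<in>S. (if s = t then 1 else 0) * Y t j) = Y s j" if "s \<in> S" for s
      using S that by (simp add: if_distrib[of "\<lambda>x. x * _"] cong: if_cong)
    ultimately show ?thesis
      using E[OF i j] by (simp add: Z_def left_diff_distrib sum_subtractf right_diff_distrib)
  qed
  then have "(\<Sum>t\<in>S. Z s t * Y t j) = 0" if "s \<in> S" "j \<in> A" for s j
    using X[of "\<lambda>s. \<Sum>t\<in>S. Z s t * Y t j" s] that by blast
  then have "Z s t = 0" if "s \<in> S" "t \<in> S" for s t
    using Y[of "Z s" t] that by blast
  then have YX: "(\<Sum>i\<in>A. Y s i * X i s) = 1" if "s \<in> S" for s
    using that by (auto simp: Z_def dest: spec)
  have "(\<Sum>i\<in>A. E i i) = (\<Sum>i\<in>A. \<Sum>s\<in>S. Y s i * X i s)"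
    using E by (simp add: mult.commute)
  also have "\<dots> = of_nat (card S)"
    using YX by (subst sum.swap) simp
  finally have "(\<Sum>i\<in>A. E i i) = of_nat (card S)" .
  then show thesis
    using that[of "card S"] E S by simp
qed

section \<open>Traces of square matrices and ranks of idempotents\<close>

lemma mat_trace_square: "A \<in> carrier_mat d d \<Longrightarrow> mat_trace A = (\<Sum>i<d. A $$ (i, i))"
  by (simp add: mat_trace_def)

lemma index_mult_square:
  assumes "A \<in> carrier_mat d d" "B \<in> carrier_mat d d" "i < d" "j < d"
  shows "(A * B) $$ (i, j) = (\<Sum>k<d. A $$ (i, k) * B $$ (k, j))"
  using assms by (auto simp: scalar_prod_def lessThan_atLeast0 intro!: sum.cong)

lemma mat_trace_mult_commute:
  fixes A B :: "'a::comm_semiring_0 mat"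
  assumes "A \<in> carrier_mat d d" "B \<in> carrier_mat d d"
  shows "mat_trace (A * B) = mat_trace (B * A)"
proof -
  have "mat_trace (A * B) = (\<Sum>i<d. \<Sum>k<d. A $$ (i, k) * B $$ (k, i))"
    using assms by (simp add: mat_trace_square[of _ d] index_mult_square[of _ d] del: index_mult_mat)
  also have "\<dots> = (\<Sum>k<d. \<Sum>i<d. A $$ (i, k) * B $$ (k, i))"
    by (rule sum.swap)
  also have "\<dots> = mat_trace (B * A)"
    using assms by (simp add: mat_trace_square[of _ d] index_mult_square[of _ d] mult.commute del: index_mult_mat)
  finally show ?thesis .
qed

lemma mat_trace_add:
  "A \<in> carrier_mat d d \<Longrightarrow> B \<in> carrier_mat d d \<Longrightarrow> mat_trace (A + B) = mat_trace A + mat_trace B"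
  by (simp add: mat_trace_square[of _ d] sum.distrib)

lemma mat_trace_minus:
  fixes A B :: "'a::ab_group_add mat"
  shows "A \<in> carrier_mat d d \<Longrightarrow> B \<in> carrier_mat d d \<Longrightarrow> mat_trace (A - B) = mat_trace A - mat_trace B"
  by (simp add: mat_trace_square[of _ d] minus_carrier_mat sum_subtractf)

lemma mat_trace_one: "mat_trace (1\<^sub>m d :: 'a::semiring_1 mat) = of_nat d"
  by (simp add: mat_trace_square[of _ d])

lemma mat_trace_idempotent:
  fixes E :: "'a::field mat"
  assumes E: "E \<in> carrier_mat d d" and idem: "E * E = E"
  obtains r :: nat where "mat_trace E = of_nat r" and "r = 0 \<Longrightarrow> E = 0\<^sub>m d d"
proof -
  have "(\<Sum>k<d. E $$ (i, k) * E $$ (k, j)) = E $$ (i, j)" if "i < d" "j < d" for i j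
    using index_mult_square[OF E E that] idem by simp
  then obtain r :: nat where "(\<Sum>i<d. E $$ (i, i)) = of_nat r"
    and "r = 0 \<Longrightarrow> \<forall>i<d. \<forall>j<d. E $$ (i, j) = 0"
    using trace_idempotent[of "{..<d}" "\<lambda>i j. E $$ (i, j)"] by (auto simp: Ball_def)
  then show thesis
    using E by (intro that[of r] eq_matI) (auto simp: mat_trace_square)
qed

lemma zero_minus_eq_mat:
  fixes A B :: "'a::ab_group_add mat"
  assumes "A \<in> carrier_mat d d" "B \<in> carrier_mat d d" "A - B = 0\<^sub>m d d"
  shows "A = B"
proof (rule eq_matI)
  fix i j assume "i < dim_row B" "j < dim_col B"
  then show "A $$ (i, j) = B $$ (i, j)"
    using arg_cong[OF assms(3), of "\<lambda>M. M $$ (i, j)"] assms(1,2) by simp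
qed (use assms in auto)

lemma minus_zero_mat:
  fixes A :: "'a::ab_group_add mat"
  assumes "A \<in> carrier_mat d d"
  shows "A - 0\<^sub>m d d = A"
  using assms by (intro eq_matI) auto

lemma idempotent_complement:
  fixes E :: "'a::ring_1 mat"
  assumes "E \<in> carrier_mat d d" "E * E = E"
  shows "(1\<^sub>m d - E) * (1\<^sub>m d - E) = 1\<^sub>m d - E"
proof -
  have "(1\<^sub>m d - E) * (1\<^sub>m d - E) = (1\<^sub>m d - E) - (E - E * E)"
    using assms(1) by (simp add: minus_mult_distrib_mat[of _ d d _ _ d]
        mult_minus_distrib_mat[of _ d d _ d] minus_carrier_mat)
  also have "\<dots> = 1\<^sub>m d - E"
    unfolding assms(2) using assms(1) by (intro eq_matI) auto
  finally show ?thesis .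
qed

text \<open>For an idempotent matrix \<open>E\<close> this is its rank.\<close>

definition nat_trace :: "'a::real_algebra_1 mat \<Rightarrow> nat"
  where "nat_trace E = (SOME r. mat_trace E = of_nat r)"

text \<open>The upper bound and the equality case come from the complement 1 - E, which is
  idempotent too: the two ranks add up to \<open>d\<close>. Characteristic zero lets the rank be
  read off from its image in the field.\<close>

lemma nat_trace_idempotent:
  fixes E :: "'a::real_field mat"
  assumes "E \<in> carrier_mat d d" "E * E = E"
  shows "mat_trace E = of_nat (nat_trace E)" and "nat_trace E = 0 \<Longrightarrow> E = 0\<^sub>m d d"
    and "nat_trace E \<le> d" and "nat_trace E = d \<Longrightarrow> E = 1\<^sub>m d"
proof -
  obtain r where r: "mat_trace E = of_nat r" "r = 0 \<Longrightarrow> E = 0\<^sub>m d d"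
    using mat_trace_idempotent[OF assms] by blast
  then have "nat_trace E = r"
    unfolding nat_trace_def by (intro some_equality) auto
  with r show "mat_trace E = of_nat (nat_trace E)" "nat_trace E = 0 \<Longrightarrow> E = 0\<^sub>m d d"
    by auto
  have E': "1\<^sub>m d - E \<in> carrier_mat d d"
    using assms(1) by (simp add: minus_carrier_mat)
  obtain r' where r': "mat_trace (1\<^sub>m d - E) = of_nat r'" "r' = 0 \<Longrightarrow> 1\<^sub>m d - E = 0\<^sub>m d d"
    using mat_trace_idempotent[OF E' idempotent_complement[OF assms]] by blast
  have "of_nat d = (of_nat (r + r') :: 'a)"
    using r r' mat_trace_minus[of "1\<^sub>m d" d E] assms(1) by (simp add: mat_trace_one algebra_simps)
  then have d: "d = r + r'"
    by (simp only: of_nat_eq_iff)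
  then show "nat_trace E \<le> d"
    using \<open>nat_trace E = r\<close> by simp
  show "E = 1\<^sub>m d" if "nat_trace E = d"
    using d that r'(2) \<open>nat_trace E = r\<close> zero_minus_eq_mat[of "1\<^sub>m d" d E] assms(1) by auto
qed

text \<open>Among the outer inverses \<open>U\<close> of \<open>T\<close> (U T U = U) one of
  greatest rank is also an inner inverse: a nonzero defect T - T U T would allow a rank one outer
  inverse \<open>W\<close>, living on the complements of U T and T U, to be added to
  \<open>U\<close>.\<close>

lemma ex_generalized_inverse:
  fixes T :: "'a::real_field mat"
  assumes T: "T \<in> carrier_mat d d"
  obtains U where "U \<in> carrier_mat d d" and "T * U * T = T"
proof -
  define out where "out U \<longleftrightarrow> U \<in> carrier_mat d d \<and> U * (T * U) = U" for U
  note minus_mult = minus_mult_distrib_mat[of _ d d _ _ d]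
    and mult_minus = mult_minus_distrib_mat[of _ d d _ d]
    and add_mult = add_mult_distrib_mat[of _ d d _ _ d]
    and mult_add = mult_add_distrib_mat[of _ d d _ d]
    and assoc = assoc_mult_mat[of _ d d _ d _ d]
    and carr = minus_carrier_mat[of _ d d] mult_carrier_mat[of _ d d _ d]
  have idem: "U * T * (U * T) = U * T" if "out U" for U
  proof -
    have "U * T * (U * T) = U * (T * U) * T"
      using conjunct1[OF that[unfolded out_def]] T by (simp add: carr assoc)
    then show ?thesis
      using that by (simp add: out_def)
  qed
  have "out (0\<^sub>m d d)"
    using T by (simp add: out_def)
  moreover have "nat_trace (U * T) < Suc d" if "out U" for U
    using nat_trace_idempotent(3)[of "U * T" d] idem[OF that] that T by (simp add: out_def carr)
  ultimately obtain U where out: "out U"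
    and max: "\<And>V. out V \<Longrightarrow> nat_trace (V * T) \<le> nat_trace (U * T)"
    using ex_has_greatest_nat[of out _ "\<lambda>U. nat_trace (U * T)" "Suc d"] by (metis less_imp_le)
  then have U: "U \<in> carrier_mat d d" and UTU: "U * (T * U) = U"
    by (auto simp: out_def)
  define N where "N = 1\<^sub>m d - U * T"
  define N' where "N' = 1\<^sub>m d - T * U"
  define D where "D = T - T * U * T"
  have C: "N \<in> carrier_mat d d" "N' \<in> carrier_mat d d" "D \<in> carrier_mat d d"
    using T U by (simp_all add: N_def N'_def D_def carr)
  have UTUT: "U * (T * (U * T)) = U * T"
    using T U UTU by (metis assoc carr(2))
  \<comment> \<open>The defect is \<open>T\<close> compressed to the two complements.\<close>
  have N'TN: "N' * (T * N) = D"
    using T U UTUT by (simp add: N_def N'_def D_def minus_mult mult_minus carr assoc minus_r_inv_mat[of _ d d] minus_zero_mat[of _ d])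
  have "D = 0\<^sub>m d d"
  proof (rule ccontr)
    assume "D \<noteq> 0\<^sub>m d d"
    then obtain i j where ij: "i < d" "j < d" "D $$ (i, j) \<noteq> 0"
      using C(3) by (metis carrier_matD(1,2) eq_matI index_zero_mat)
    \<comment> \<open>The matrix unit is transposed and scaled against a nonzero entry of
      \<open>D\<close> so that E D E = E and tr(E D) = 1.\<close>
    define E where "E = mat d d (\<lambda>(k, l). if k = j \<and> l = i then 1 / D $$ (i, j) else 0)"
    define W where "W = N * (E * N')"
    have CE: "E \<in> carrier_mat d d"
      by (simp add: E_def)
    have CW: "W \<in> carrier_mat d d"
      using C CE by (simp add: W_def carr)
    have E: "E $$ (k, l) = (if k = j \<and> l = i then 1 / D $$ (i, j) else 0)" if "k < d" "l < d" for k l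
      using that by (simp add: E_def)
    have ED: "(E * D) $$ (k, l) = (if k = j then D $$ (i, l) / D $$ (i, j) else 0)"
      if "k < d" "l < d" for k l
      using that ij by (simp add: index_mult_square[OF CE C(3)] E if_distrib[of "\<lambda>x. x * _"]
          cong: if_cong del: index_mult_mat)
    have EDE: "E * D * E = E"
    proof (rule eq_matI)
      fix k l assume "k < dim_row E" "l < dim_col E"
      then have kl: "k < d" "l < d"
        by (auto simp: E_def)
      show "(E * D * E) $$ (k, l) = E $$ (k, l)"
        using kl ij by (subst index_mult_square[OF _ CE])
          (simp_all add: ED carr CE C(3) E if_distrib[of "\<lambda>x. x * _"]
              if_distrib[of "\<lambda>x. _ * x"] if_distrib[of "\<lambda>x. x / _"] cong: if_cong del: index_mult_mat)
    qed (use CE C in auto)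
    have trED: "mat_trace (E * D) = 1"
      using ij CE C by (simp add: mat_trace_square[of _ d] ED del: index_mult_mat)
    have WTW: "W * (T * W) = W"
    proof -
      have "W * (T * W) = N * (E * (N' * (T * N)) * E * N')"
        using C CE T by (simp add: W_def carr assoc)
      also have "\<dots> = N * (E * D * E * N')"
        unfolding N'TN by simp
      finally show ?thesis
        unfolding EDE W_def .
    qed
    have UTW: "U * (T * W) = 0\<^sub>m d d"
    proof -
      have "U * (T * N) = 0\<^sub>m d d"
        using T U UTUT by (simp add: N_def mult_minus carr assoc)
      then have "U * (T * N) * (E * N') = 0\<^sub>m d d"
        using CE C by simp
      then show ?thesis
        using T U C CE by (simp add: W_def carr assoc)
    qed
    have WTU: "W * (T * U) = 0\<^sub>m d d"
    proof -
      have "N' * (T * U) = 0\<^sub>m d d"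
        using T U UTU by (simp add: N'_def minus_mult carr assoc)
      then have "N * (E * (N' * (T * U))) = 0\<^sub>m d d"
        using CE C by simp
      then show ?thesis
        using T U C CE by (simp add: W_def carr assoc)
    qed
    \<comment> \<open>The mixed terms vanish because U T N = 0 and N' T U = 0.\<close>
    have "out (U + W)"
      using T U CW UTU WTW UTW WTU unfolding out_def
      by (simp add: add_mult mult_add carr)
    have trWT: "mat_trace (W * T) = 1"
    proof -
      have "mat_trace (W * T) = mat_trace (N * (E * N' * T))"
        using T C CE by (simp add: W_def carr assoc)
      also have "\<dots> = mat_trace (E * N' * T * N)"
        using T C CE by (intro mat_trace_mult_commute[of _ d]) (simp_all add: carr)
      also have "E * N' * T * N = E * D"
        unfolding N'TN[symmetric] using T C CE by (simp add: carr assoc)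
      finally show ?thesis
        using trED by simp
    qed
    have "mat_trace ((U + W) * T) = mat_trace (U * T) + 1"
      using T U CW trWT by (simp add: add_mult mat_trace_add[of _ d] carr)
    moreover have "(U + W) * T \<in> carrier_mat d d" "U * T \<in> carrier_mat d d"
      using T U CW by (simp_all add: carr)
    ultimately have "(of_nat (nat_trace ((U + W) * T)) :: 'a) = of_nat (Suc (nat_trace (U * T)))"
      using nat_trace_idempotent(1)[OF _ idem[OF \<open>out (U + W)\<close>], of d]
        nat_trace_idempotent(1)[OF _ idem[OF out], of d] by simp
    then have "nat_trace ((U + W) * T) = Suc (nat_trace (U * T))"
      by (simp only: of_nat_eq_iff)
    then show False
      using max[OF \<open>out (U + W)\<close>] by simp
  qed
  then have "T * U * T = T"
    using zero_minus_eq_mat[of T d "T * U * T"] T U by (simp add: D_def carr)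
  then show thesis
    using that U by blast
qed

section \<open>Representations with equal traces are isomorphic\<close>

lemma (in group) sum_translate:
  assumes "g \<in> carrier G"
  shows "(\<Sum>h\<in>carrier G. f (g \<otimes> h)) = (\<Sum>h\<in>carrier G. f h)"
  by (rule sum.reindex_bij_witness[where i = "\<lambda>h. inv g \<otimes> h" and j = "\<lambda>h. g \<otimes> h"])
    (use assms in \<open>auto simp: m_assoc[symmetric]\<close>)

locale finite_group_rep = group G for G (structure) +
  fixes d :: nat and \<rho> :: "_ \<Rightarrow> complex mat"
  assumes finite_group: "finite (carrier G)"
    and rep_carrier: "g \<in> carrier G \<Longrightarrow> \<rho> g \<in> carrier_mat d d"
    and rep_mult: "g \<in> carrier G \<Longrightarrow> h \<in> carrier G \<Longrightarrow> \<rho> (g \<otimes> h) = \<rho> g * \<rho> h"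
    and rep_one: "\<rho> \<one> = 1\<^sub>m d"

lemma finite_group_repI:
  assumes "group G" "finite (carrier G)" "complex_rep G d \<rho>"
  shows "finite_group_rep G d \<rho>"
proof -
  have "ring (ring_mat TYPE(complex) d ())"
    by (rule ring_mat)
  then have M: "monoid (ring_mat TYPE(complex) d ())"
    by (simp add: ring_def)
  have hom: "\<rho> \<in> hom G (GL d)"
    using assms(3) by (simp add: complex_rep_def)
  have "\<rho> \<one>\<^bsub>G\<^esub> = \<one>\<^bsub>GL d\<^esub>"
    by (rule hom_one[OF hom assms(1) monoid.units_group[OF M]])
  moreover have "\<rho> g \<in> carrier_mat d d" if "g \<in> carrier G" for g
    using hom_in_carrier[OF hom that] by (auto simp: units_of_def Units_def ring_mat_simps)
  ultimately show ?thesis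
    using assms hom unfolding finite_group_rep_def finite_group_rep_axioms_def
    by (auto simp: hom_def units_of_def ring_mat_simps)
qed

text \<open>The left-hand side is \<open>card G\<close> times the rank of the projection of the \<open>d \<times> d\<close> matrices
  onto the equivariant endomorphisms of the image of \<open>P\<close>; this avoids unitary structures.\<close>

lemma (in finite_group_rep) character_inner_product_nonzero:
  assumes P: "P \<in> carrier_mat d d" and idem: "P * P = P" and nz: "P \<noteq> 0\<^sub>m d d"
    and comm: "\<And>g. g \<in> carrier G \<Longrightarrow> \<rho> g * P = P * \<rho> g"
  shows "(\<Sum>g\<in>carrier G. mat_trace (\<rho> g * P) * mat_trace (P * \<rho> (inv g))) \<noteq> 0"
proof
  assume zero: "(\<Sum>g\<in>carrier G. mat_trace (\<rho> g * P) * mat_trace (P * \<rho> (inv g))) = 0"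
  define c :: complex where "c = of_nat (card (carrier G))"
  have c: "c \<noteq> 0"
    using finite_group one_closed by (auto simp: c_def)
  note assoc = assoc_mult_mat[of _ d d _ d _ d] and carr = mult_carrier_mat[of _ d d _ d]
  note idx = index_mult_square[of _ d]
  \<comment> \<open>These are the matrix coefficients of the operator sending B to \<rho>(g) P B P
    \<rho>(g)^-1, with (i, j) the input and (k, l) the output position. \<open>E\<close> below is
    its average over the group, with pairs as indices.\<close>
  define F where "F g k i j l = (\<rho> g * P) $$ (k, i) * (P * \<rho> (inv g)) $$ (j, l)" for g k i j l
  define E where "E x y = (\<Sum>g\<in>carrier G. F g (fst x) (fst y) (snd y) (snd x)) / c" for x y
  define A where "A = {..<d} \<times> {..<d}"
  have PP: "(\<rho> g * P) * (\<rho> h * P) = \<rho> (g \<otimes> h) * P" "(P * \<rho> (inv h)) * (P * \<rho> (inv g)) = P * \<rho> (inv (g \<otimes> h))"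
    if "g \<in> carrier G" "h \<in> carrier G" for g h
  proof -
    have "(\<rho> g * P) * (\<rho> h * P) = \<rho> g * ((P * \<rho> h) * P)"
      using that P by (simp add: assoc carr rep_carrier)
    also have "\<dots> = \<rho> g * \<rho> h * (P * P)"
      using that P by (simp add: assoc carr rep_carrier comm[symmetric] del: idem)
    finally show "(\<rho> g * P) * (\<rho> h * P) = \<rho> (g \<otimes> h) * P"
      using that by (simp add: idem rep_mult)
    have "(P * \<rho> (inv h)) * (P * \<rho> (inv g)) = P * ((\<rho> (inv h) * P) * \<rho> (inv g))"
      using that P by (simp add: assoc carr rep_carrier)
    also have "\<dots> = (P * P) * (\<rho> (inv h) * \<rho> (inv g))"
      using that P by (simp add: assoc carr rep_carrier comm)
    finally show "(P * \<rho> (inv h)) * (P * \<rho> (inv g)) = P * \<rho> (inv (g \<otimes> h))"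
      using that by (simp add: idem rep_mult inv_mult_group)
  qed
  have FF: "(\<Sum>y\<in>A. F g k (fst y) (snd y) l * F h (fst y) a b (snd y)) = F (g \<otimes> h) k a b l"
    if "g \<in> carrier G" "h \<in> carrier G" "k < d" "l < d" "a < d" "b < d" for g h k l a b
  proof -
    have "(\<Sum>y\<in>A. F g k (fst y) (snd y) l * F h (fst y) a b (snd y))
        = (\<Sum>i<d. (\<rho> g * P) $$ (k, i) * (\<rho> h * P) $$ (i, a))
          * (\<Sum>j<d. (P * \<rho> (inv h)) $$ (b, j) * (P * \<rho> (inv g)) $$ (j, l))"
      unfolding A_def by (simp add: F_def sum.cartesian_product sum_product mult_ac split_def)
    also have "\<dots> = F (g \<otimes> h) k a b l"
      unfolding F_def PP(1)[OF that(1,2), symmetric] PP(2)[OF that(1,2), symmetric]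
      using that P by (simp add: idx carr rep_carrier del: index_mult_mat assoc_mult_mat)
    finally show ?thesis .
  qed
  have E_idem: "(\<Sum>y\<in>A. E x y * E y z) = E x z" if "x \<in> A" "z \<in> A" for x z
  proof -
    have "(\<Sum>y\<in>A. E x y * E y z) = (\<Sum>y\<in>A. \<Sum>g\<in>carrier G. \<Sum>h\<in>carrier G.
        F g (fst x) (fst y) (snd y) (snd x) * F h (fst y) (fst z) (snd z) (snd y)) / (c * c)"
      by (simp add: E_def sum_product sum_divide_distrib)
    also have "\<dots> = (\<Sum>g\<in>carrier G. \<Sum>h\<in>carrier G. \<Sum>y\<in>A.
        F g (fst x) (fst y) (snd y) (snd x) * F h (fst y) (fst z) (snd z) (snd y)) / (c * c)"
      by (subst sum.swap, subst (2) sum.swap) (rule refl)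
    also have "\<dots> = (\<Sum>g\<in>carrier G. \<Sum>h\<in>carrier G. F (g \<otimes> h) (fst x) (fst z) (snd z) (snd x)) / (c * c)"
      using that by (intro arg_cong2[where f = "(/)"] sum.cong refl FF) (auto simp: A_def)
    also have "\<dots> = (c * (\<Sum>h\<in>carrier G. F h (fst x) (fst z) (snd z) (snd x))) / (c * c)"
      by (simp add: sum_translate[of _ "\<lambda>g. F g (fst x) (fst z) (snd z) (snd x)"] c_def)
    also have "\<dots> = E x z"
      using c by (simp add: E_def)
    finally show ?thesis .
  qed
  have "(\<Sum>x\<in>A. E x x) = 0"
  proof -
    have "(\<Sum>x\<in>A. E x x) = (\<Sum>g\<in>carrier G. \<Sum>x\<in>A. F g (fst x) (fst x) (snd x) (snd x)) / c"
      unfolding E_def by (subst sum.swap) (simp add: sum_divide_distrib)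
    also have "(\<Sum>g\<in>carrier G. \<Sum>x\<in>A. F g (fst x) (fst x) (snd x) (snd x))
        = (\<Sum>g\<in>carrier G. mat_trace (\<rho> g * P) * mat_trace (P * \<rho> (inv g)))"
      using P unfolding A_def
      by (intro sum.cong refl) (simp add: F_def sum.cartesian_product sum_product
          mat_trace_square[of _ d] carr rep_carrier split_def del: index_mult_mat)
    finally show ?thesis
      using zero by simp
  qed
  moreover obtain r :: nat where "(\<Sum>x\<in>A. E x x) = of_nat r" "r = 0 \<Longrightarrow> \<forall>x\<in>A. \<forall>y\<in>A. E x y = 0"
    by (rule trace_idempotent[of A E]) (use E_idem in \<open>auto simp: A_def\<close>)
  ultimately have E0: "E x y = 0" if "x \<in> A" "y \<in> A" for x y
    using that by simp
  have "P $$ (k, l) = 0" if kl: "k < d" "l < d" for k l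
  proof -
    \<comment> \<open>\<open>P\<close> is fixed by each operator, hence by their average, which is
      now known to be zero.\<close>
    have "(\<Sum>y\<in>A. F g k (fst y) (snd y) l * P $$ y) = P $$ (k, l)" if g: "g \<in> carrier G" for g
    proof -
      have "(\<Sum>y\<in>A. F g k (fst y) (snd y) l * P $$ y)
          = (\<Sum>i<d. \<Sum>j<d. (\<rho> g * P) $$ (k, i) * P $$ (i, j) * (P * \<rho> (inv g)) $$ (j, l))"
        unfolding A_def by (simp add: F_def sum.cartesian_product mult_ac split_def)
      also have "\<dots> = (\<rho> g * P * P * (P * \<rho> (inv g))) $$ (k, l)"
        using kl P g by (subst sum.swap)
          (simp add: idx carr rep_carrier sum_distrib_right del: index_mult_mat assoc_mult_mat)
      also have "\<rho> g * P * P * (P * \<rho> (inv g)) = \<rho> g * ((P * P) * P) * \<rho> (inv g)"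
        using P g by (simp add: assoc carr rep_carrier)
      also have "\<dots> = P * (\<rho> g * \<rho> (inv g))"
        using P g by (simp add: idem comm assoc carr rep_carrier)
      also have "\<dots> = P"
        using P g by (simp add: rep_mult[symmetric] rep_one)
      finally show ?thesis .
    qed
    then have "(\<Sum>g\<in>carrier G. \<Sum>y\<in>A. F g k (fst y) (snd y) l * P $$ y) = c * P $$ (k, l)"
      by (simp add: c_def)
    moreover have "(\<Sum>g\<in>carrier G. \<Sum>y\<in>A. F g k (fst y) (snd y) l * P $$ y)
        = (\<Sum>y\<in>A. c * E (k, l) y * P $$ y)"
      using c by (subst sum.swap) (simp add: E_def sum_distrib_right)
    moreover have "\<dots> = 0"
      using E0 kl by (intro sum.neutral) (auto simp: A_def)
    ultimately show ?thesis
      using c by simp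
  qed
  then have "P = 0\<^sub>m d d"
    using P by (intro eq_matI) auto
  then show False
    using nz by simp
qed

section \<open>Averaging over a finite group\<close>

text \<open>The dimension is an argument because an empty family of matrices does not determine
  it.\<close>

definition mat_sum :: "nat \<Rightarrow> 'i set \<Rightarrow> ('i \<Rightarrow> 'a::comm_monoid_add mat) \<Rightarrow> 'a mat"
  where "mat_sum d I F = mat d d (\<lambda>ij. \<Sum>g\<in>I. F g $$ ij)"

lemma mat_sum_carrier [simp]: "mat_sum d I F \<in> carrier_mat d d"
  by (simp add: mat_sum_def)

lemma mat_sum_cong: "(\<And>g. g \<in> I \<Longrightarrow> F g = F' g) \<Longrightarrow> mat_sum d I F = mat_sum d I F'"
  by (simp add: mat_sum_def)

lemma mat_sum_mult_left:
  fixes X :: "'a::semiring_0 mat"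
  assumes "X \<in> carrier_mat d d" "\<And>g. g \<in> I \<Longrightarrow> F g \<in> carrier_mat d d"
  shows "X * mat_sum d I F = mat_sum d I (\<lambda>g. X * F g)"
proof (rule eq_matI)
  fix i j assume "i < dim_row (mat_sum d I (\<lambda>g. X * F g))" "j < dim_col (mat_sum d I (\<lambda>g. X * F g))"
  then have ij: "i < d" "j < d"
    by (simp_all add: mat_sum_def)
  have "(X * mat_sum d I F) $$ (i, j) = (\<Sum>k<d. \<Sum>g\<in>I. X $$ (i, k) * F g $$ (k, j))"
    using assms ij by (simp add: index_mult_square[of _ d] mat_sum_def sum_distrib_left del: index_mult_mat)
  also have "\<dots> = (\<Sum>g\<in>I. (X * F g) $$ (i, j))"
    using assms ij by (subst sum.swap) (simp add: index_mult_square[of _ d] del: index_mult_mat)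
  finally show "(X * mat_sum d I F) $$ (i, j) = mat_sum d I (\<lambda>g. X * F g) $$ (i, j)"
    using ij by (simp add: mat_sum_def)
qed (use assms in \<open>simp_all add: mat_sum_def\<close>)

lemma mat_sum_mult_right:
  fixes X :: "'a::semiring_0 mat"
  assumes "X \<in> carrier_mat d d" "\<And>g. g \<in> I \<Longrightarrow> F g \<in> carrier_mat d d"
  shows "mat_sum d I F * X = mat_sum d I (\<lambda>g. F g * X)"
proof (rule eq_matI)
  fix i j assume "i < dim_row (mat_sum d I (\<lambda>g. F g * X))" "j < dim_col (mat_sum d I (\<lambda>g. F g * X))"
  then have ij: "i < d" "j < d"
    by (simp_all add: mat_sum_def)
  have "(mat_sum d I F * X) $$ (i, j) = (\<Sum>k<d. \<Sum>g\<in>I. F g $$ (i, k) * X $$ (k, j))"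
    using assms ij by (simp add: index_mult_square[of _ d] mat_sum_def sum_distrib_right del: index_mult_mat)
  also have "\<dots> = (\<Sum>g\<in>I. (F g * X) $$ (i, j))"
    using assms ij by (subst sum.swap) (simp add: index_mult_square[of _ d] del: index_mult_mat)
  finally show "(mat_sum d I F * X) $$ (i, j) = mat_sum d I (\<lambda>g. F g * X) $$ (i, j)"
    using ij by (simp add: mat_sum_def)
qed (use assms in \<open>simp_all add: mat_sum_def\<close>)

lemma mat_sum_const:
  "A \<in> carrier_mat d d \<Longrightarrow> mat_sum d I (\<lambda>g. A) = of_nat (card I) \<cdot>\<^sub>m (A :: 'a::semiring_1 mat)"
  by (intro eq_matI) (auto simp: mat_sum_def)

locale two_group_reps = finite_group_rep G d \<rho> + cod: finite_group_rep G d \<sigma>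
  for G (structure) and d \<rho> \<sigma>
begin

definition intertwiner :: "complex mat \<Rightarrow> bool"
  where "intertwiner T \<longleftrightarrow> T \<in> carrier_mat d d \<and> (\<forall>g\<in>carrier G. T * \<rho> g = \<sigma> g * T)"

text \<open>There is no division by the group order; the missing factor reappears as
  \<open>c\<close> when an inverse is averaged.\<close>

definition average :: "complex mat \<Rightarrow> complex mat"
  where "average A = mat_sum d (carrier G) (\<lambda>g. \<sigma> g * A * \<rho> (inv g))"

lemma intertwiner_average:
  assumes A: "A \<in> carrier_mat d d"
  shows "intertwiner (average A)"
  unfolding intertwiner_def
proof (intro conjI ballI)
  fix h assume h: "h \<in> carrier G"
  note carr = mult_carrier_mat[of _ d d _ d] and assoc = assoc_mult_mat[of _ d d _ d _ d]
  have "\<sigma> h * average A = mat_sum d (carrier G) (\<lambda>g. \<sigma> h * (\<sigma> g * A * \<rho> (inv g)))"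
    using h A unfolding average_def
    by (intro mat_sum_mult_left) (simp_all add: carr rep_carrier cod.rep_carrier)
  also have "\<dots> = mat_sum d (carrier G) (\<lambda>g. \<sigma> (h \<otimes> g) * A * \<rho> (inv (h \<otimes> g)) * \<rho> h)"
  proof (rule mat_sum_cong)
    fix g assume g: "g \<in> carrier G"
    have "\<rho> (inv (h \<otimes> g)) * \<rho> h = \<rho> (inv g)"
      using g h by (simp add: rep_mult[symmetric] inv_mult_group m_assoc)
    then have "\<sigma> (h \<otimes> g) * A * \<rho> (inv (h \<otimes> g)) * \<rho> h = \<sigma> (h \<otimes> g) * A * \<rho> (inv g)"
      using g h A by (simp add: carr assoc rep_carrier cod.rep_carrier)
    then show "\<sigma> h * (\<sigma> g * A * \<rho> (inv g)) = \<sigma> (h \<otimes> g) * A * \<rho> (inv (h \<otimes> g)) * \<rho> h"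
      using g h A by (simp add: carr assoc rep_carrier cod.rep_carrier cod.rep_mult)
  qed
  also have "\<dots> = mat_sum d (carrier G) (\<lambda>g. \<sigma> g * A * \<rho> (inv g) * \<rho> h)"
    unfolding mat_sum_def
    by (intro cong_mat refl) (rule sum_translate[OF h, of "\<lambda>g. (\<sigma> g * A * \<rho> (inv g) * \<rho> h) $$ _"])
  also have "\<dots> = average A * \<rho> h"
    using h A unfolding average_def
    by (intro mat_sum_mult_right[symmetric]) (simp_all add: carr rep_carrier cod.rep_carrier)
  finally show "average A * \<rho> h = \<sigma> h * average A" ..
qed (simp add: average_def)

end

text \<open>Consider pairs of intertwiners T, U in opposite directions that are generalized inverses
  of each other, with U T of greatest rank. If P = 1 - U T were nonzero, the complements cut out by
  P and by Q = 1 - T U would still have equal characters, so a nonzero intertwiner would exist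
  between them. Adding it to T, and a matching inverse to U, would raise the rank.\<close>

lemma isomorphic_reps_of_mat_trace_eq:
  fixes G (structure)
  assumes G: "group G" and fin: "finite (carrier G)"
    and \<rho>: "complex_rep G d \<rho>" and \<sigma>: "complex_rep G d \<sigma>"
    and tr: "\<And>g. g \<in> carrier G \<Longrightarrow> mat_trace (\<rho> g) = mat_trace (\<sigma> g)"
  shows "isomorphic_reps G d \<rho> \<sigma>"
proof -
  interpret group G by (rule G)
  interpret R: finite_group_rep G d \<rho> by (rule finite_group_repI[OF G fin \<rho>])
  interpret S: finite_group_rep G d \<sigma> by (rule finite_group_repI[OF G fin \<sigma>])
  interpret RS: two_group_reps G d \<rho> \<sigma> ..
  interpret SR: two_group_reps G d \<sigma> \<rho> ..
  note minus_mult = minus_mult_distrib_mat[of _ d d _ _ d]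
    and mult_minus = mult_minus_distrib_mat[of _ d d _ d]
    and add_mult = add_mult_distrib_mat[of _ d d _ _ d]
    and mult_add = mult_add_distrib_mat[of _ d d _ d]
    and assoc = assoc_mult_mat[of _ d d _ d _ d]
    and carr = minus_carrier_mat[of _ d d] mult_carrier_mat[of _ d d _ d]
    and one = left_mult_one_mat[of _ d d] right_mult_one_mat[of _ d d]
    and zero = left_mult_zero_mat[of _ d d] right_mult_zero_mat[of _ d d]
    and repc = R.rep_carrier S.rep_carrier
  define good where "good TU \<longleftrightarrow> RS.intertwiner (fst TU) \<and> SR.intertwiner (snd TU) \<and>
    fst TU * (snd TU * fst TU) = fst TU \<and> snd TU * (fst TU * snd TU) = snd TU" for TU
  define rk where "rk TU = nat_trace (snd TU * fst TU)" for TU :: "complex mat \<times> complex mat"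
  have idem: "snd TU * fst TU \<in> carrier_mat d d" "snd TU * fst TU * (snd TU * fst TU) = snd TU * fst TU"
    if "good TU" for TU
  proof -
    have C: "fst TU \<in> carrier_mat d d" "snd TU \<in> carrier_mat d d"
      using that by (auto simp: good_def RS.intertwiner_def SR.intertwiner_def)
    then show "snd TU * fst TU \<in> carrier_mat d d"
      by (rule carr(2)[rotated])
    have "snd TU * fst TU * (snd TU * fst TU) = snd TU * (fst TU * (snd TU * fst TU))"
      using C by (simp add: assoc carr)
    then show "snd TU * fst TU * (snd TU * fst TU) = snd TU * fst TU"
      using that by (simp add: good_def)
  qed
  have "good (0\<^sub>m d d, 0\<^sub>m d d)"
    using repc by (simp add: good_def RS.intertwiner_def SR.intertwiner_def zero)
  moreover have "rk TU < Suc d" if "good TU" for TU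
    using nat_trace_idempotent(3)[OF idem[OF that]] by (simp add: rk_def)
  ultimately obtain TU where good: "good TU" and max: "\<And>V. good V \<Longrightarrow> rk V \<le> rk TU"
    using ex_has_greatest_nat[of good _ rk "Suc d"] by (metis less_imp_le)
  define T U where "T = fst TU" and "U = snd TU"
  have T: "T \<in> carrier_mat d d" and T\<rho>: "\<And>g. g \<in> carrier G \<Longrightarrow> T * \<rho> g = \<sigma> g * T"
    and U: "U \<in> carrier_mat d d" and U\<sigma>: "\<And>g. g \<in> carrier G \<Longrightarrow> U * \<sigma> g = \<rho> g * U"
    and TUT: "T * (U * T) = T" and UTU: "U * (T * U) = U"
    using good by (auto simp: T_def U_def good_def RS.intertwiner_def SR.intertwiner_def)
  have idUT: "U * T * (U * T) = U * T"
    using idem(2)[OF good] by (simp add: T_def U_def)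
  define P where "P = 1\<^sub>m d - U * T"
  define Q where "Q = 1\<^sub>m d - T * U"
  have P: "P \<in> carrier_mat d d" and Q: "Q \<in> carrier_mat d d"
    using T U by (simp_all add: P_def Q_def carr)
  have PP: "P * P = P"
    unfolding P_def using T U idUT by (intro idempotent_complement) (simp_all add: carr)
  have QQ: "Q * Q = Q"
    unfolding Q_def
  proof (rule idempotent_complement)
    have "T * U * (T * U) = T * (U * (T * U))"
      using T U by (simp add: assoc carr)
    then show "T * U * (T * U) = T * U"
      by (simp add: UTU)
  qed (use T U in \<open>simp add: carr\<close>)
  have TP: "T * P = 0\<^sub>m d d" and QT: "Q * T = 0\<^sub>m d d" and PU: "P * U = 0\<^sub>m d d" and UQ: "U * Q = 0\<^sub>m d d"
    using T U TUT UTU by (simp_all add: P_def Q_def mult_minus minus_mult carr assoc)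
  have P\<rho>: "\<rho> g * P = P * \<rho> g" and Q\<sigma>: "\<sigma> g * Q = Q * \<sigma> g" if g: "g \<in> carrier G" for g
  proof -
    have "U * (T * \<rho> g) = \<rho> g * U * T"
      using T U g repc by (simp add: T\<rho> U\<sigma>[symmetric] assoc[symmetric] carr del: assoc_mult_mat)
    then show "\<rho> g * P = P * \<rho> g"
      using T U g repc by (simp add: P_def mult_minus minus_mult carr assoc one)
    have "T * (U * \<sigma> g) = \<sigma> g * T * U"
      using T U g repc by (simp add: U\<sigma> T\<rho>[symmetric] assoc[symmetric] carr del: assoc_mult_mat)
    then show "\<sigma> g * Q = Q * \<sigma> g"
      using T U g repc by (simp add: Q_def mult_minus minus_mult carr assoc one)
  qed
  \<comment> \<open>Equality of the traces survives on the complements, because cyclicity of the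
    trace gives T U and U T the same contribution.\<close>
  have trPQ: "mat_trace (\<sigma> g * Q) = mat_trace (\<rho> g * P)" if g: "g \<in> carrier G" for g
  proof -
    have "mat_trace (\<sigma> g * (T * U)) = mat_trace (T * \<rho> g * U)"
      using T U g repc by (simp add: T\<rho> assoc carr)
    also have "\<dots> = mat_trace (U * (T * \<rho> g))"
      using T U g repc by (intro mat_trace_mult_commute[of _ d]) (simp_all add: carr)
    also have "\<dots> = mat_trace (U * T * \<rho> g)"
      using T U g repc by (simp add: assoc carr)
    also have "\<dots> = mat_trace (\<rho> g * (U * T))"
      using T U g repc by (intro mat_trace_mult_commute[of _ d]) (simp_all add: carr)
    finally show ?thesis
      using T U g repc tr[OF g]
      by (simp add: P_def Q_def mult_minus mat_trace_minus[of _ d] carr one)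
  qed
  have "P = 0\<^sub>m d d"
  proof (rule ccontr)
    assume nz: "P \<noteq> 0\<^sub>m d d"
    \<comment> \<open>If all these averages vanished, the character sum of \<open>P\<close> with
      itself would be zero once tr(\<rho>(g) P) is rewritten as tr(\<sigma>(g) Q).\<close>
    have "\<exists>A\<in>carrier_mat d d. RS.average (Q * A * P) \<noteq> 0\<^sub>m d d"
    proof (rule ccontr)
      assume H: "\<not> (\<exists>A\<in>carrier_mat d d. RS.average (Q * A * P) \<noteq> 0\<^sub>m d d)"
      have zero: "(\<Sum>g\<in>carrier G. (\<sigma> g * Q) $$ (k, k) * (P * \<rho> (inv g)) $$ (l, l)) = 0"
        if kl: "k < d" "l < d" for k l
      proof -
        \<comment> \<open>A matrix unit isolates one product of diagonal entries; summing these
          products over k and l gives the product of the traces.\<close>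
        define A :: "complex mat" where "A = mat d d (\<lambda>(i, j). if i = k \<and> j = l then 1 else 0)"
        have A: "A \<in> carrier_mat d d"
          by (simp add: A_def)
        have Aij: "A $$ (i, j) = (if i = k \<and> j = l then 1 else 0)" if "i < d" "j < d" for i j
          using that by (simp add: A_def)
        have "(\<sigma> g * (Q * A * P) * \<rho> (inv g)) $$ (k, l) = (\<sigma> g * Q) $$ (k, k) * (P * \<rho> (inv g)) $$ (l, l)"
          if g: "g \<in> carrier G" for g
        proof -
          define X where "X = \<sigma> g * Q"
          define Y where "Y = P * \<rho> (inv g)"
          have XY: "X \<in> carrier_mat d d" "Y \<in> carrier_mat d d"
            using P Q g repc by (simp_all add: X_def Y_def carr)
          have "\<sigma> g * (Q * A * P) * \<rho> (inv g) = X * (A * Y)"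
            using A P Q g repc by (simp add: X_def Y_def assoc carr)
          moreover have AY: "(A * Y) $$ (i, l) = (if i = k then Y $$ (l, l) else 0)" if "i < d" for i
            using that kl by (simp add: index_mult_square[OF A XY(2)] Aij
                if_distrib[of "\<lambda>x. x * _"] cong: if_cong del: index_mult_mat)
          moreover have "(X * (A * Y)) $$ (k, l) = X $$ (k, k) * Y $$ (l, l)"
            using kl A XY by (subst index_mult_square[of _ d])
              (simp_all add: AY carr if_distrib[of "\<lambda>x. _ * x"] cong: if_cong del: index_mult_mat)
          ultimately show ?thesis
            by (simp add: X_def Y_def)
        qed
        then have "(\<Sum>g\<in>carrier G. (\<sigma> g * Q) $$ (k, k) * (P * \<rho> (inv g)) $$ (l, l))
            = RS.average (Q * A * P) $$ (k, l)"
          using kl by (simp add: RS.average_def mat_sum_def)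
        also have "\<dots> = 0"
          using H A kl by auto
        finally show ?thesis .
      qed
      have "(\<Sum>g\<in>carrier G. mat_trace (\<rho> g * P) * mat_trace (P * \<rho> (inv g)))
          = (\<Sum>g\<in>carrier G. \<Sum>k<d. \<Sum>l<d. (\<sigma> g * Q) $$ (k, k) * (P * \<rho> (inv g)) $$ (l, l))"
        using P Q repc
        by (intro sum.cong refl, subst trPQ[symmetric], simp)
          (simp add: mat_trace_square[of _ d] carr sum_product del: index_mult_mat)
      also have "\<dots> = (\<Sum>k<d. \<Sum>l<d. \<Sum>g\<in>carrier G. (\<sigma> g * Q) $$ (k, k) * (P * \<rho> (inv g)) $$ (l, l))"
        by (subst sum.swap, rule sum.cong[OF refl], rule sum.swap)
      also have "\<dots> = 0"
        using zero by simp
      finally show False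
        using R.character_inner_product_nonzero[OF P PP nz P\<rho>] by simp
    qed
    then obtain A where A: "A \<in> carrier_mat d d" and SS: "RS.average (Q * A * P) \<noteq> 0\<^sub>m d d"
      by blast
    define S where "S = RS.average (Q * A * P)"
    have "RS.intertwiner S"
      unfolding S_def using A P Q by (intro RS.intertwiner_average) (simp add: carr)
    then have S: "S \<in> carrier_mat d d" and S\<rho>: "\<And>g. g \<in> carrier G \<Longrightarrow> S * \<rho> g = \<sigma> g * S"
      by (auto simp: RS.intertwiner_def)
    have QS: "Q * S = S"
    proof -
      have "Q * (\<sigma> g * (Q * A * P) * \<rho> (inv g)) = \<sigma> g * (Q * A * P) * \<rho> (inv g)" if g: "g \<in> carrier G" for g
      proof -
        have "Q * (\<sigma> g * (Q * A * P) * \<rho> (inv g)) = (Q * \<sigma> g) * (Q * (A * P * \<rho> (inv g)))"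
          using A P Q g repc by (simp add: assoc carr)
        also have "\<dots> = \<sigma> g * ((Q * Q) * (A * P * \<rho> (inv g)))"
          using A P Q g repc by (simp add: Q\<sigma>[symmetric] assoc carr del: QQ)
        finally show ?thesis
          using A P Q g repc by (simp add: QQ assoc carr)
      qed
      then show ?thesis
        unfolding S_def RS.average_def using A P Q repc
        by (subst mat_sum_mult_left) (auto simp: carr intro!: mat_sum_cong)
    qed
    have SP: "S * P = S"
    proof -
      have "\<sigma> g * (Q * A * P) * \<rho> (inv g) * P = \<sigma> g * (Q * A * P) * \<rho> (inv g)" if g: "g \<in> carrier G" for g
      proof -
        have "\<sigma> g * (Q * A * P) * \<rho> (inv g) * P = \<sigma> g * (Q * A) * (P * (\<rho> (inv g) * P))"
          using A P Q g repc by (simp add: assoc carr)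
        also have "\<dots> = \<sigma> g * (Q * A) * ((P * P) * \<rho> (inv g))"
          using A P Q g repc by (simp add: P\<rho> assoc carr)
        finally show ?thesis
          using A P Q g repc by (simp add: PP assoc carr)
      qed
      then show ?thesis
        unfolding S_def RS.average_def using A P Q repc
        by (subst mat_sum_mult_right) (auto simp: carr intro!: mat_sum_cong)
    qed
    \<comment> \<open>An arbitrary generalized inverse of \<open>S\<close> becomes equivariant by
      averaging; since \<open>S\<close> intertwines, averaging only multiplies S W0 S by the group
      order.\<close>
    obtain W0 where W0: "W0 \<in> carrier_mat d d" and SW0S: "S * W0 * S = S"
      using ex_generalized_inverse[OF S] by blast
    define c :: complex where "c = of_nat (card (carrier G))"
    have c: "c \<noteq> 0"
      using fin one_closed by (auto simp: c_def)
    define W1 where "W1 = SR.average W0"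
    have "SR.intertwiner W1"
      unfolding W1_def using W0 by (rule SR.intertwiner_average)
    then have W1: "W1 \<in> carrier_mat d d" and W1\<sigma>: "\<And>g. g \<in> carrier G \<Longrightarrow> W1 * \<sigma> g = \<rho> g * W1"
      by (auto simp: SR.intertwiner_def)
    have SW1S: "S * W1 * S = c \<cdot>\<^sub>m S"
    proof -
      have "S * W1 * S = mat_sum d (carrier G) (\<lambda>g. S * (\<rho> g * W0 * \<sigma> (inv g)) * S)"
        unfolding W1_def SR.average_def using S W0 repc
        by (simp add: mat_sum_mult_left mat_sum_mult_right carr)
      also have "\<dots> = mat_sum d (carrier G) (\<lambda>g. S)"
      proof (rule mat_sum_cong)
        fix g assume g: "g \<in> carrier G"
        have "S * (\<rho> g * W0 * \<sigma> (inv g)) * S = (S * \<rho> g) * W0 * (\<sigma> (inv g) * S)"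
          using S W0 g repc by (simp add: assoc carr)
        also have "\<dots> = \<sigma> g * (S * W0 * S) * \<rho> (inv g)"
          using S W0 g repc S\<rho>[of "inv g"] by (simp add: S\<rho>[OF g] assoc carr)
        also have "\<dots> = S * (\<rho> g * \<rho> (inv g))"
          using S W0 g repc unfolding SW0S S\<rho>[OF g, symmetric] by (simp add: assoc carr)
        also have "\<dots> = S"
          using S g by (simp add: R.rep_mult[symmetric] R.rep_one)
        finally show "S * (\<rho> g * W0 * \<sigma> (inv g)) * S = S" .
      qed
      finally show ?thesis
        using S by (simp add: mat_sum_const c_def)
    qed
    \<comment> \<open>The scalar makes up for the unnormalized average. The factors \<open>P\<close>
      and \<open>Q\<close> make the mixed products T W and W T vanish, since T P = 0 and Q T =
      0.\<close>
    define W2 where "W2 = P * ((1 / c) \<cdot>\<^sub>m W1) * Q"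
    have W2: "W2 \<in> carrier_mat d d"
      using P Q W1 by (simp add: W2_def carr)
    have SW2S: "S * W2 * S = S"
    proof -
      have "S * W2 * S = (S * P) * ((1 / c) \<cdot>\<^sub>m W1) * (Q * S)"
        using S P Q W1 by (simp add: W2_def assoc carr)
      also have "\<dots> = (1 / c) \<cdot>\<^sub>m (S * W1 * S)"
        unfolding SP QS using S W1 by (simp add: mult_smult_distrib[of _ d d _ d] mult_smult_assoc_mat[of _ d d _ d] carr)
      also have "\<dots> = S"
        unfolding SW1S using S c by (intro eq_matI) auto
      finally show ?thesis .
    qed
    have W2\<sigma>: "W2 * \<sigma> g = \<rho> g * W2" if g: "g \<in> carrier G" for g
    proof -
      have "W2 * \<sigma> g = P * (((1 / c) \<cdot>\<^sub>m W1) * (Q * \<sigma> g))"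
        using P Q W1 g repc by (simp add: W2_def assoc carr)
      also have "\<dots> = P * ((1 / c) \<cdot>\<^sub>m (W1 * \<sigma> g)) * Q"
        using P Q W1 g repc
        by (simp add: Q\<sigma>[symmetric] assoc carr mult_smult_assoc_mat[of _ d d _ d])
      also have "\<dots> = (P * \<rho> g) * ((1 / c) \<cdot>\<^sub>m W1) * Q"
        using P Q W1 g repc
        by (simp add: W1\<sigma> assoc carr mult_smult_assoc_mat[of _ d d _ d] mult_smult_distrib[of _ d d _ d])
      also have "\<dots> = \<rho> g * W2"
        using P Q W1 g repc by (simp add: P\<rho>[symmetric] W2_def assoc carr)
      finally show ?thesis .
    qed
    have PW2: "P * W2 = W2"
    proof -
      have "P * W2 = (P * P) * (((1 / c) \<cdot>\<^sub>m W1) * Q)"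
        using P Q W1 by (simp add: W2_def assoc carr)
      then show ?thesis
        using P Q W1 by (simp add: W2_def PP assoc carr)
    qed
    have W2Q: "W2 * Q = W2"
    proof -
      have "W2 * Q = P * ((1 / c) \<cdot>\<^sub>m W1) * (Q * Q)"
        using P Q W1 by (simp add: W2_def assoc carr)
      then show ?thesis
        using P Q W1 by (simp add: W2_def QQ assoc carr)
    qed
    \<comment> \<open>\<open>W2\<close> is only an inner inverse of \<open>S\<close>; this product
      is an outer inverse as well.\<close>
    define W where "W = W2 * S * W2"
    have W: "W \<in> carrier_mat d d"
      using W2 S by (simp add: W_def carr)
    have SWS: "S * (W * S) = S"
    proof -
      have "S * (W * S) = (S * W2 * S) * W2 * S"
        using S W2 by (simp add: W_def assoc carr)
      then show ?thesis
        by (simp add: SW2S)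
    qed
    have WSW: "W * (S * W) = W"
    proof -
      have "W * (S * W) = W2 * ((S * W2 * S) * W2 * S) * W2"
        using S W2 by (simp add: W_def assoc carr)
      then show ?thesis
        by (simp add: SW2S W_def)
    qed
    have W\<sigma>: "W * \<sigma> g = \<rho> g * W" if g: "g \<in> carrier G" for g
    proof -
      have "W * \<sigma> g = W2 * (S * (W2 * \<sigma> g))"
        using S W2 g repc by (simp add: W_def assoc carr)
      also have "\<dots> = W2 * ((S * \<rho> g) * W2)"
        using S W2 g repc by (simp add: W2\<sigma> assoc carr)
      also have "\<dots> = (W2 * \<sigma> g) * (S * W2)"
        using S W2 g repc by (simp add: S\<rho> assoc carr)
      also have "\<dots> = \<rho> g * W"
        using S W2 g repc by (simp add: W2\<sigma> W_def assoc carr)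
      finally show ?thesis .
    qed
    have PW: "P * W = W"
    proof -
      have "P * W = (P * W2) * (S * W2)"
        using P W2 S by (simp add: W_def assoc carr)
      then show ?thesis
        using W2 S by (simp add: PW2 W_def assoc carr)
    qed
    have WQ: "W * Q = W"
      using Q W2 S by (simp add: W_def W2Q assoc carr)
    have TW: "T * W = 0\<^sub>m d d"
    proof -
      have "T * W = (T * P) * W"
        using T P W by (simp add: PW assoc)
      then show ?thesis
        using W by (simp add: TP)
    qed
    have SU: "S * U = 0\<^sub>m d d"
    proof -
      have "S * U = (S * P) * U"
        unfolding SP ..
      then show ?thesis
        using S P U by (simp add: PU assoc)
    qed
    have US: "U * S = 0\<^sub>m d d"
    proof -
      have "U * S = (U * Q) * S"
        using U Q S by (simp add: QS assoc)
      then show ?thesis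
        using S by (simp add: UQ)
    qed
    have WT: "W * T = 0\<^sub>m d d"
    proof -
      have "W * T = (W * Q) * T"
        unfolding WQ ..
      then show ?thesis
        using W Q T by (simp add: QT assoc)
    qed
    have prod: "(U + W) * (T + S) = U * T + W * S"
      using T U S W US WT by (simp add: add_mult mult_add carr)
    have "(T + S) * ((U + W) * (T + S)) = T + S"
    proof -
      have "T * (W * S) = (T * W) * S" "S * (U * T) = (S * U) * T"
        using T U S W by (simp_all add: assoc)
      then have "T * (W * S) = 0\<^sub>m d d" "S * (U * T) = 0\<^sub>m d d"
        using T S by (simp_all add: TW SU)
      then show ?thesis
        unfolding prod using T U S W TUT SWS by (simp add: add_mult mult_add carr)
    qed
    moreover have "(U + W) * ((T + S) * (U + W)) = U + W"
    proof -
      have "(T + S) * (U + W) = T * U + S * W"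
        using T U S W TW SU by (simp add: add_mult mult_add carr)
      moreover have "U * (S * W) = (U * S) * W" "W * (T * U) = (W * T) * U"
        using T U S W by (simp_all add: assoc)
      then have "U * (S * W) = 0\<^sub>m d d" "W * (T * U) = 0\<^sub>m d d"
        using U W by (simp_all add: US WT)
      ultimately show ?thesis
        using T U S W UTU WSW by (simp add: add_mult mult_add carr)
    qed
    moreover have "RS.intertwiner (T + S)" "SR.intertwiner (U + W)"
      using T U S W repc T\<rho> U\<sigma> S\<rho> W\<sigma>
      by (simp_all add: RS.intertwiner_def SR.intertwiner_def add_mult mult_add)
    ultimately have good': "good (T + S, U + W)"
      by (simp add: good_def)
    have "W * S * (W * S) = W * S"
    proof -
      have "W * S * (W * S) = W * (S * (W * S))"
        using W S by (simp add: assoc carr)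
      then show ?thesis
        by (simp add: SWS)
    qed
    note WS = nat_trace_idempotent[of "W * S" d, OF _ this]
    have "nat_trace (W * S) \<noteq> 0"
    proof
      assume "nat_trace (W * S) = 0"
      then have "W * S = 0\<^sub>m d d"
        using WS(2) W S by (simp add: carr)
      then have "S = 0\<^sub>m d d"
        using SWS S by simp
      then show False
        using SS by (simp add: S_def)
    qed
    moreover have "(of_nat (rk (T + S, U + W)) :: complex) = of_nat (rk TU + nat_trace (W * S))"
      using nat_trace_idempotent(1)[OF idem[OF good']] nat_trace_idempotent(1)[OF idem[OF good]] WS(1) T U S W
      by (simp add: rk_def prod mat_trace_add[of _ d] carr T_def[symmetric] U_def[symmetric])
    then have "rk (T + S, U + W) = rk TU + nat_trace (W * S)"
      by (simp only: of_nat_eq_iff)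
    ultimately show False
      using max[OF good'] by simp
  qed
  then have UT1: "U * T = 1\<^sub>m d"
    using zero_minus_eq_mat[of "1\<^sub>m d" d "U * T"] T U by (simp add: P_def carr)
  \<comment> \<open>At the identity the equality of traces shows that \<open>Q\<close> has rank 0 as
    \<open>P\<close> does, so \<open>U\<close> is a two-sided inverse of \<open>T\<close>.\<close>
  have "mat_trace Q = mat_trace P"
    using trPQ[OF one_closed] P Q by (simp add: R.rep_one S.rep_one)
  then have "mat_trace Q = of_nat 0"
    using \<open>P = 0\<^sub>m d d\<close> by (simp add: mat_trace_square[of _ d])
  then have "nat_trace Q = 0"
    using nat_trace_idempotent(1)[OF Q QQ] by (simp only: of_nat_eq_iff)
  then have "T * U = 1\<^sub>m d"
    using nat_trace_idempotent(2)[OF Q QQ] zero_minus_eq_mat[of "1\<^sub>m d" d "T * U"] T U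
    by (simp add: Q_def carr)
  then have "T \<in> carrier (GL d)"
    using T U UT1 by (auto simp: units_of_def Units_def ring_mat_simps)
  then show ?thesis
    unfolding isomorphic_reps_def using T\<rho> by blast
qed

section \<open>Cycles of permutations\<close>

text \<open>The iterates before the first return to x are distinct and exhaust the cycle, so the
  return time is the cycle length.\<close>

lemma funpow_eq_iff_cong:
  assumes "permutation f"
  shows "(f ^^ i) x = (f ^^ j) x \<longleftrightarrow> [i = j] (mod card (orbit f x))"
proof -
  let ?p = "funpow_dist1 f x x"
  have x: "x \<in> orbit f x"
    using assms by (rule permutation_self_in_orbit)
  have inj: "inj_on (\<lambda>n. (f ^^ n) x) {0..<?p}"
    using x by (rule inj_on_funpow_dist1)
  then have p: "card (orbit f x) = ?p"
    unfolding orbit_conv_funpow_dist1[OF x] by (simp add: card_image)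
  have mod: "(f ^^ (i mod ?p)) x = (f ^^ i) x" for i
    by (rule funpow_mod_eq) (rule funpow_dist1_prop[OF x])
  have "(f ^^ i) x = (f ^^ j) x \<longleftrightarrow> (f ^^ (i mod ?p)) x = (f ^^ (j mod ?p)) x"
    by (simp only: mod)
  also have "\<dots> \<longleftrightarrow> i mod ?p = j mod ?p"
    using inj by (auto simp: inj_on_def)
  finally show ?thesis
    by (simp add: p cong_def)
qed

lemma funpow_eq_self_iff_dvd:
  assumes "permutation f"
  shows "(f ^^ i) x = x \<longleftrightarrow> card (orbit f x) dvd i"
  using funpow_eq_iff_cong[OF assms, of i x 0] by (simp add: cong_0_iff)

lemma finite_orbit_permutation: "permutation f \<Longrightarrow> finite (orbit f x)"
  by (rule finite_orbit) (rule permutation_self_in_orbit)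

lemma card_orbit_pos: "permutation f \<Longrightarrow> card (orbit f x) > 0"
  by (simp add: card_gt_0_iff finite_orbit_permutation orbit_nonempty)

lemma orbit_eq_permutation: "permutation f \<Longrightarrow> y \<in> orbit f x \<Longrightarrow> orbit f y = orbit f x"
  using orbit_cyclic_eq3[OF cyclic_on_orbit'] .

lemma orbit_apply_permutation: "permutation f \<Longrightarrow> orbit f (f x) = orbit f x"
  by (rule orbit_eq_permutation) (auto intro: orbit.base)

lemma orbit_funpow_permutation: "permutation f \<Longrightarrow> orbit f ((f ^^ i) x) = orbit f x"
  by (rule orbit_eq_permutation) (auto simp: orbit_altdef_permutation)

lemma orbit_subset_closed:
  assumes "\<And>y. y \<in> X \<Longrightarrow> f y \<in> X" "x \<in> X"
  shows "orbit f x \<subseteq> X"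
proof
  fix y assume "y \<in> orbit f x"
  then show "y \<in> X"
    by induction (use assms in auto)
qed

lemma Min_orbit_in: "permutation f \<Longrightarrow> Min (orbit f (x :: 'a::linorder)) \<in> orbit f x"
  by (rule Min_in) (simp_all add: finite_orbit_permutation orbit_nonempty)

lemma funpow_conjugate:
  assumes "bij w"
  shows "((w \<circ> g \<circ> inv' w) ^^ i) (w x) = w ((g ^^ i) x)"
  by (induction i) (use assms in \<open>simp_all add: bij_is_inj\<close>)

lemma orbit_conjugate:
  assumes "bij w"
  shows "orbit (w \<circ> g \<circ> inv' w) (w x) = w ` orbit g x"
  unfolding orbit_altdef using funpow_conjugate[OF assms] by auto

lemma card_orbit_conjugate:
  assumes "bij w"
  shows "card (orbit (w \<circ> g \<circ> inv' w) (w x)) = card (orbit g x)"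
  unfolding orbit_conjugate[OF assms] using assms
  by (intro card_image) (auto simp: bij_def inj_on_def)

section \<open>Powers of a root of unity\<close>

text \<open>This is Bezout's identity; for T = 0 the gcd is k itself, which is congruent to 0, so
  any u serves.\<close>

lemma ex_mult_cong_gcd:
  fixes T k :: nat
  assumes "k > 0"
  shows "\<exists>u. [u * T = gcd T k] (mod k)"
proof (cases "T = 0")
  case True
  then show ?thesis
    by (auto simp: cong_def)
next
  case False
  then show ?thesis
    using cong_solve_nat[of T k] by (simp add: mult.commute)
qed

text \<open>On each stratum \<open>gcd T k = b\<close> the exponent is \<open>b\<close> times an inverse of \<open>T / b\<close>
  modulo \<open>k / b\<close>, so the exponents run through all residues.\<close>

lemma sum_root_gcd_inverse:
  fixes z :: "'a::field" and u :: "nat \<Rightarrow> nat"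
  assumes k: "k > 0" and z: "z ^ k = 1" "z \<noteq> 1"
    and u: "\<And>T. [u T * T = gcd T k] (mod k)"
  shows "(\<Sum>t<k. z ^ (gcd (t + t0) k * u (t + t0))) = 0"
proof -
  define e where "e T = gcd T k * u T" for T
  have decomp: "\<exists>T' d. T = gcd T k * T' \<and> k = gcd T k * d \<and> [u T * T' = 1] (mod d)" for T
  proof -
    define b where "b = gcd T k"
    have b: "b > 0"
      using k by (simp add: b_def)
    obtain T' d where T': "T = b * T'" and d: "k = b * d"
      unfolding b_def by (meson dvdE gcd_dvd1 gcd_dvd2)
    have "[b * (u T * T') = b * 1] (mod (b * d))"
      using u[of T] unfolding b_def[symmetric] by (simp add: T' d[symmetric] mult_ac)
    then have "[u T * T' = 1] (mod d)"
      using b by (metis cong_mult_lcancel_nat cong_modulus_mult_nat mult_cancel_left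
          mult_mod_right cong_def not_gr_zero)
    then show ?thesis
      using T' d unfolding b_def[symmetric] by blast
  qed
  \<comment> \<open>\<open>u T\<close> is a unit modulo \<open>k / gcd T k\<close>, so the exponent
    stays in the stratum of \<open>T\<close>. Congruent exponents therefore come from the same
    stratum, where inverses modulo a common \<open>d\<close> can be compared.\<close>
  have gcd_e: "gcd (e T) k = gcd T k" for T
  proof -
    obtain T' d where T': "T = gcd T k * T'" and d: "k = gcd T k * d" and uT: "[u T * T' = 1] (mod d)"
      using decomp by blast
    have "coprime (u T) d"
      using uT by (metis cong_imp_coprime cong_sym coprime_1_left coprime_mult_left_iff)
    then have "gcd (gcd T k * u T) (gcd T k * d) = gcd T k"
      by (simp add: gcd_mult_distrib_nat[symmetric])
    then show ?thesis
      unfolding e_def d[symmetric] .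
  qed
  have inj: "[T1 = T2] (mod k)" if e: "[e T1 = e T2] (mod k)" for T1 T2
  proof -
    define b where "b = gcd T1 k"
    have b2: "b = gcd T2 k"
      using cong_gcd_eq[OF e] by (simp add: gcd_e b_def)
    have b: "b > 0"
      using k by (simp add: b_def)
    obtain T1' d where T1: "T1 = b * T1'" and d: "k = b * d" and u1: "[u T1 * T1' = 1] (mod d)"
      using decomp[of T1] unfolding b_def by blast
    obtain T2' d2 where T2: "T2 = b * T2'" and d2: "k = b * d2" and u2': "[u T2 * T2' = 1] (mod d2)"
      using decomp[of T2] unfolding b2 by blast
    have "d2 = d"
      using d d2 b by simp
    then have u2: "[u T2 * T2' = 1] (mod d)"
      using u2' by simp
    have "[b * u T1 = b * u T2] (mod (b * d))"
      using e d b2 unfolding e_def b_def by simp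
    then have u12: "[u T1 = u T2] (mod d)"
      using b by (simp add: cong_def mult_mod_right[symmetric])
    have "[T1' * (u T2 * T2') = T1' * 1] (mod d)"
      using u2 by (rule cong_scalar_left)
    moreover have "[T1' * (u T2 * T2') = T1' * (u T1 * T2')] (mod d)"
      using u12 by (intro cong_scalar_left cong_scalar_right) (rule cong_sym)
    moreover have "[T1' * (u T1 * T2') = T2' * 1] (mod d)"
      using cong_scalar_left[OF u1, of T2'] by (simp only: mult_ac)
    ultimately have "[T1' = T2'] (mod d)"
      by (simp only: cong_def mult_1_right)
    then show ?thesis
      unfolding T1 T2 d by (simp add: cong_def mult_mod_right[symmetric])
  qed
  have "inj_on (\<lambda>t. e (t + t0) mod k) {..<k}"
  proof (rule inj_onI)
    fix s t assume st: "s \<in> {..<k}" "t \<in> {..<k}" and "e (s + t0) mod k = e (t + t0) mod k"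
    then have "[e (s + t0) = e (t + t0)] (mod k)"
      by (simp add: cong_def)
    then have "[s + t0 = t + t0] (mod k)"
      by (rule inj)
    then have "[s = t] (mod k)"
      by (simp add: cong_add_rcancel_nat)
    then show "s = t"
      using st by (simp add: cong_def)
  qed
  moreover have "(\<lambda>t. e (t + t0) mod k) ` {..<k} \<subseteq> {..<k}"
    using k by auto
  ultimately have bij: "bij_betw (\<lambda>t. e (t + t0) mod k) {..<k} {..<k}"
    by (simp add: bij_betw_def card_image card_subset_eq)
  have "z ^ e T = z ^ (e T mod k)" for T
  proof -
    have "z ^ e T = (z ^ k) ^ (e T div k) * z ^ (e T mod k)"
      by (simp only: power_mult[symmetric] power_add[symmetric] mult_div_mod_eq)
    then show ?thesis
      by (simp add: z)
  qed
  then have "(\<Sum>t<k. z ^ e (t + t0)) = (\<Sum>t<k. z ^ (e (t + t0) mod k))"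
    by simp
  also have "\<dots> = (\<Sum>j<k. z ^ j)"
    using bij by (rule sum.reindex_bij_betw)
  \<comment> \<open>The exponents run through all residues, so the geometric sum vanishes although z
    need not be primitive.\<close>
  also have "\<dots> = 0"
    using geometric_sum[OF z(2), of k] z(1) by simp
  finally show ?thesis
    by (simp add: e_def)
qed

lemma power_eq_1_coprime:
  fixes z :: "'a::field"
  assumes "z ^ a = 1" "z ^ b = 1" "coprime a b" "a > 0"
  shows "z = 1"
proof -
  obtain x y where xy: "a * x = b * y + 1"
    using bezout_nat[of a b] assms(3,4) by auto
  have "z ^ (a * x) = z ^ (b * y) * z"
    by (simp add: xy)
  then show ?thesis
    by (simp add: power_mult assms)
qed

section \<open>The twisted conjugation cocycle\<close>

locale coprime_split =
  fixes n M M' :: nat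
  assumes fact_eq: "fact n = M * M'"
    and coprime: "coprime M M'"
begin

abbreviation perms :: "(nat \<Rightarrow> nat) set"
  where "perms \<equiv> {p. p permutes {1..n}}"

definition zeta :: "nat \<Rightarrow> complex"
  where "zeta k = cis (2 * pi * real M' / real k)"

lemma zeta_nonzero [simp]: "zeta k \<noteq> 0"
  by (simp add: zeta_def)

text \<open>Both sides have the same angle because m/a = b/k. This converts a root attached to a
  cycle of \<open>G t\<close> into the root attached to the chosen cycle of w.\<close>

lemma zeta_power_eq:
  assumes "a * b = m * k" "a > 0" "k > 0"
  shows "zeta a ^ m = zeta k ^ b"
proof -
  have "real a * real b = real m * real k"
    using assms(1) by (metis of_nat_mult)
  then have "real m * (2 * pi * real M' / real a) = real b * (2 * pi * real M' / real k)"
    using assms(2,3) by (simp add: field_simps)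
  then show ?thesis
    unfolding zeta_def DeMoivre by simp
qed

lemma zeta_power_self: "k > 0 \<Longrightarrow> zeta k ^ k = 1"
  unfolding zeta_def DeMoivre by (simp add: cis_multiple_2pi)

lemma zeta_power_cong: "k > 0 \<Longrightarrow> [i = j] (mod k) \<Longrightarrow> zeta k ^ i = zeta k ^ j"
proof -
  assume k: "k > 0" and ij: "[i = j] (mod k)"
  have "zeta k ^ i = zeta k ^ (i mod k)" for i
  proof -
    have "zeta k ^ i = (zeta k ^ k) ^ (i div k) * zeta k ^ (i mod k)"
      by (simp only: power_mult[symmetric] power_add[symmetric] mult_div_mod_eq)
    then show ?thesis
      by (simp add: k zeta_power_self)
  qed
  then show ?thesis
    using ij by (metis cong_def)
qed

lemma zeta_eq_1_iff:
  assumes "k > 0"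
  shows "zeta k = 1 \<longleftrightarrow> k dvd M'"
proof
  assume "zeta k = 1"
  then have "cos (2 * pi * real M' / real k) = 1"
    by (simp add: zeta_def complex_eq_iff)
  then obtain i :: int where "2 * pi * real M' / real k = of_int i * 2 * pi"
    by (auto simp: cos_one_2pi_int)
  then have "real M' = of_int i * real k"
    using assms by (simp add: field_simps)
  then have "int M' = i * int k"
    by (metis of_int_eq_iff of_int_mult of_int_of_nat_eq)
  then show "k dvd M'"
    by (metis dvd_triv_right int_dvd_int_iff)
next
  assume "k dvd M'"
  then obtain c where "M' = k * c" ..
  then have "2 * pi * real M' / real k = 2 * pi * real c"
    using assms by simp
  then show "zeta k = 1"
    unfolding zeta_def by (simp only: cis_multiple_2pi Ints_of_nat)
qed

lemma zeta_power_M: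
  assumes "k > 0" "k \<le> n"
  shows "zeta k ^ M = 1"
proof -
  have "k dvd M * M'"
    using assms dvd_fact[of k n] fact_eq by auto
  then obtain c where c: "M * M' = k * c" ..
  have "real M * (2 * pi * real M' / real k) = 2 * pi * (real (M * M') / real k)"
    by simp
  also have "\<dots> = 2 * pi * real c"
    unfolding c using assms by simp
  finally show ?thesis
    unfolding zeta_def DeMoivre by (simp add: cis_multiple_2pi)
qed

text \<open>On each cycle of a permutation g this is an eigenfunction for the shift by g with
  eigenvalue \<open>zeta k\<close>, equal to 1 at the least point. The exponent is determined only
  modulo the cycle length, which \<open>zeta_power_self\<close> absorbs.\<close>

definition theta :: "(nat \<Rightarrow> nat) \<Rightarrow> nat \<Rightarrow> complex"
  where "theta g x = zeta (card (orbit g x)) ^ (SOME l. (g ^^ l) (Min (orbit g x)) = x)"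

text \<open>The property of \<open>theta\<close> that matters is isolated, so that another
  eigenfunction can replace it in \<open>alpha_commuting\<close>.\<close>

definition eigenfun :: "(nat \<Rightarrow> complex) \<Rightarrow> (nat \<Rightarrow> nat) \<Rightarrow> nat set \<Rightarrow> bool"
  where "eigenfun \<theta> g X \<longleftrightarrow>
    (\<forall>x\<in>X. g x \<in> X \<and> \<theta> x \<noteq> 0 \<and> \<theta> (g x) = zeta (card (orbit g x)) * \<theta> x)"

lemma theta_nonzero [simp]: "theta g x \<noteq> 0"
  by (simp add: theta_def)

lemma theta_step:
  assumes g: "permutation g"
  shows "theta g (g x) = zeta (card (orbit g x)) * theta g x"
proof -
  define k where "k = card (orbit g x)"
  define y where "y = Min (orbit g x)"
  have y: "y \<in> orbit g x"
    unfolding y_def using g by (rule Min_orbit_in)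
  then have orb: "orbit g y = orbit g x"
    using g by (rule orbit_eq_permutation[rotated])
  have ex: "\<exists>l. (g ^^ l) y = z" if "z \<in> orbit g x" for z
    using that orbit_altdef_permutation[OF g, of y] unfolding orb by auto
  have x: "(g ^^ (SOME l. (g ^^ l) y = x)) y = x"
    by (rule someI_ex, rule ex) (rule permutation_self_in_orbit[OF g])
  have gx: "(g ^^ (SOME l. (g ^^ l) y = g x)) y = g x"
    by (rule someI_ex, rule ex) (rule orbit.base)
  have "(g ^^ (SOME l. (g ^^ l) y = g x)) y = (g ^^ Suc (SOME l. (g ^^ l) y = x)) y"
    unfolding gx by (simp add: x)
  then have "[(SOME l. (g ^^ l) y = g x) = Suc (SOME l. (g ^^ l) y = x)] (mod k)"
    unfolding funpow_eq_iff_cong[OF g] orb k_def .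
  then have "zeta k ^ (SOME l. (g ^^ l) y = g x) = zeta k ^ Suc (SOME l. (g ^^ l) y = x)"
    using card_orbit_pos[OF g, of x] by (intro zeta_power_cong) (simp_all add: k_def)
  then show ?thesis
    by (simp add: theta_def orbit_apply_permutation[OF g] k_def y_def)
qed

lemma perms_permutation: "p \<in> perms \<Longrightarrow> permutation p"
  by (auto simp: permutation_permutes)

lemma card_orbit_le:
  assumes "g \<in> perms" "x \<in> {1..n}"
  shows "card (orbit g x) \<le> n"
proof -
  have "orbit g x \<subseteq> {1..n}"
    using assms by (intro permutes_orbit_subset) auto
  then have "card (orbit g x) \<le> card {1..n}"
    by (intro card_mono) simp_all
  then show ?thesis
    by simp
qed

lemma theta_power_M:
  assumes "g \<in> perms" "x \<in> {1..n}"
  shows "theta g x ^ M = 1"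
  using assms card_orbit_pos[OF perms_permutation, of g x] card_orbit_le[OF assms]
  by (simp add: theta_def power_mult[symmetric] mult.commute[of _ M] power_mult zeta_power_M)

end

section \<open>Products over the cycles of a permutation\<close>

text \<open>The least point is an arbitrary representative; the value is meaningful for functions
  that are constant on cycles.\<close>

definition orbit_prod :: "(nat \<Rightarrow> nat) \<Rightarrow> nat set \<Rightarrow> (nat \<Rightarrow> 'a) \<Rightarrow> 'a::comm_monoid_mult"
  where "orbit_prod g X \<phi> = (\<Prod>c\<in>orbit g ` X. \<phi> (Min c))"

definition invariant_on :: "(nat \<Rightarrow> nat) \<Rightarrow> nat set \<Rightarrow> (nat \<Rightarrow> 'a) \<Rightarrow> bool"
  where "invariant_on g X \<phi> \<longleftrightarrow> (\<forall>x\<in>X. g x \<in> X \<and> \<phi> (g x) = \<phi> x)"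

lemma invariant_on_orbit:
  assumes "invariant_on g X \<phi>" "x \<in> X" "y \<in> orbit g x"
  shows "y \<in> X \<and> \<phi> y = \<phi> x"
  using assms(3)
proof induction
  case base
  show ?case
    using assms(1,2) by (auto simp: invariant_on_def)
next
  case (step y)
  then show ?case
    using assms(1) by (auto simp: invariant_on_def)
qed

lemma invariant_on_Min_orbit:
  assumes "permutation g" "invariant_on g X \<phi>" "x \<in> X"
  shows "\<phi> (Min (orbit g x)) = \<phi> x"
  using invariant_on_orbit[OF assms(2,3) Min_orbit_in[OF assms(1)]] by simp

lemma orbit_prod_cong:
  assumes "permutation g" "invariant_on g X \<phi>" "\<And>x. x \<in> X \<Longrightarrow> \<phi> x = \<psi> x"
  shows "orbit_prod g X \<phi> = orbit_prod g X \<psi>"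
  unfolding orbit_prod_def
proof (rule prod.cong[OF refl])
  fix c assume "c \<in> orbit g ` X"
  then obtain x where x: "x \<in> X" "c = orbit g x"
    by blast
  show "\<phi> (Min c) = \<psi> (Min c)"
    using invariant_on_orbit[OF assms(2) x(1) Min_orbit_in[OF assms(1), of x]] assms(3) x(2) by auto
qed

text \<open>Conjugation by w carries cycles to cycles but not least points to least points;
  invariance of \<phi> repairs this.\<close>

lemma orbit_prod_transport:
  assumes g: "permutation g" and w: "bij w" and inv: "invariant_on (w \<circ> g \<circ> inv' w) (w ` X) \<phi>"
    and X: "\<And>x. x \<in> X \<Longrightarrow> g x \<in> X" and w': "permutation w"
  shows "orbit_prod (w \<circ> g \<circ> inv' w) (w ` X) \<phi> = orbit_prod g X (\<lambda>x. \<phi> (w x))"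
proof -
  let ?h = "w \<circ> g \<circ> inv' w"
  have h: "permutation ?h"
    using g w' by (intro permutation_compose permutation_inverse)
  have wg: "?h (w x) = w (g x)" for x
    using w by (simp add: bij_is_inj)
  have inv': "invariant_on g X (\<lambda>x. \<phi> (w x))"
    using inv X unfolding invariant_on_def by (auto simp: wg[symmetric] simp del: o_apply)
  have im: "orbit ?h ` w ` X = (`) w ` orbit g ` X"
    by (auto simp: image_image orbit_conjugate[OF w])
  have inj: "inj_on ((`) w) (orbit g ` X)"
    using w by (meson bij_is_inj inj_image_eq_iff inj_onI)
  have "orbit_prod ?h (w ` X) \<phi> = (\<Prod>c\<in>orbit g ` X. \<phi> (Min (w ` c)))"
    unfolding orbit_prod_def im by (subst prod.reindex[OF inj]) simp
  also have "\<dots> = (\<Prod>c\<in>orbit g ` X. \<phi> (w (Min c)))"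
  proof (rule prod.cong[OF refl])
    fix c assume "c \<in> orbit g ` X"
    then obtain x where x: "x \<in> X" "c = orbit g x"
      by blast
    have "\<phi> (Min (w ` c)) = \<phi> (w x)"
      using invariant_on_Min_orbit[OF h inv, of "w x"] x by (simp add: orbit_conjugate[OF w])
    also have "\<dots> = \<phi> (w (Min c))"
      using invariant_on_Min_orbit[OF g inv' x(1)] x(2) by simp
    finally show "\<phi> (Min (w ` c)) = \<phi> (w (Min c))" .
  qed
  finally show ?thesis
    by (simp add: orbit_prod_def)
qed

lemma orbit_prod_mult: "orbit_prod g X (\<lambda>x. \<phi> x * \<psi> x) = orbit_prod g X \<phi> * orbit_prod g X \<psi>"
  by (simp add: orbit_prod_def prod.distrib)

lemma orbit_prod_divide:
  fixes \<phi> \<psi> :: "nat \<Rightarrow> 'a::field"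
  shows "orbit_prod g X (\<lambda>x. \<phi> x / \<psi> x) = orbit_prod g X \<phi> / orbit_prod g X \<psi>"
  by (simp add: orbit_prod_def prod_dividef)

lemma orbit_prod_Un:
  assumes "permutation g" "finite X" "finite Y" "X \<inter> Y = {}"
    and "\<And>x. x \<in> X \<Longrightarrow> g x \<in> X" "\<And>x. x \<in> Y \<Longrightarrow> g x \<in> Y"
  shows "orbit_prod g (X \<union> Y) \<phi> = orbit_prod g X \<phi> * orbit_prod g Y \<phi>"
proof -
  have "orbit g ` X \<inter> orbit g ` Y = {}"
  proof (rule ccontr)
    assume "orbit g ` X \<inter> orbit g ` Y \<noteq> {}"
    then obtain x y where xy: "x \<in> X" "y \<in> Y" "orbit g x = orbit g y"
      by blast
    have "x \<in> orbit g x"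
      using assms(1) by (rule permutation_self_in_orbit)
    then have "x \<in> Y"
      using orbit_subset_closed[of Y g y] assms(6) xy by auto
    then show False
      using xy assms(4) by blast
  qed
  then show ?thesis
    using assms unfolding orbit_prod_def image_Un by (intro prod.union_disjoint) auto
qed

lemma conjugate_eq_self:
  assumes "bij w" "g \<circ> w = w \<circ> g"
  shows "w \<circ> g \<circ> inv' w = g"
  using assms by (metis bij_def comp_assoc comp_id surj_iff)

lemma funpow_commute:
  assumes "f \<circ> g = g \<circ> f"
  shows "f ((g ^^ i) x) = (g ^^ i) (f x)"
  by (induction i) (use assms in \<open>auto simp: fun_eq_iff\<close>)

lemma funpow_in_closed: "(\<And>y. y \<in> X \<Longrightarrow> f y \<in> X) \<Longrightarrow> x \<in> X \<Longrightarrow> (f ^^ i) x \<in> X"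
  by (induction i) auto

context coprime_split
begin

lemma perms_bij: "p \<in> perms \<Longrightarrow> bij p"
  by (auto intro: permutes_bij)

lemma perms_image: "p \<in> perms \<Longrightarrow> p ` {1..n} = {1..n}"
  by (simp add: permutes_image)

lemma perms_in: "p \<in> perms \<Longrightarrow> p x \<in> {1..n} \<longleftrightarrow> x \<in> {1..n}"
  by (simp add: permutes_in_image del: atLeastAtMost_iff)

lemma perms_conjugate: "w \<in> perms \<Longrightarrow> g \<in> perms \<Longrightarrow> w \<circ> g \<circ> inv' w \<in> perms"
  by (simp add: permutes_compose permutes_inv)

text \<open>The factor for a cycle measures how far w moves its base point away from the base point
  of the image cycle. If w is itself a k-cycle of g, its own cycle contributes \<open>zeta k\<close>
  and every other cycle 1.\<close>

definition alpha :: "(nat \<Rightarrow> nat) \<Rightarrow> (nat \<Rightarrow> nat) \<Rightarrow> complex"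
  where "alpha w g = orbit_prod g {1..n} (\<lambda>x. theta (w \<circ> g \<circ> inv' w) (w x) / theta g x)"

lemma theta_conjugate_step:
  assumes "w \<in> perms" "g \<in> perms"
  shows "theta (w \<circ> g \<circ> inv' w) (w (g x)) = zeta (card (orbit g x)) * theta (w \<circ> g \<circ> inv' w) (w x)"
proof -
  have "w (g x) = (w \<circ> g \<circ> inv' w) (w x)"
    using perms_bij[OF assms(1)] by (simp add: bij_is_inj)
  then show ?thesis
    using theta_step[OF perms_permutation[OF perms_conjugate[OF assms]], of "w x"]
    by (simp only: card_orbit_conjugate[OF perms_bij[OF assms(1)]])
qed

text \<open>Conjugation preserves cycle lengths, so a step along g multiplies numerator and
  denominator by the same root.\<close>

lemma invariant_on_theta_ratio:
  assumes "w \<in> perms" "g \<in> perms"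
  shows "invariant_on g {1..n} (\<lambda>x. theta (w \<circ> g \<circ> inv' w) (w x) / theta g x)"
  unfolding invariant_on_def
  using perms_in[OF assms(2)]
  by (simp only: theta_conjugate_step[OF assms] theta_step[OF perms_permutation[OF assms(2)]]) simp

text \<open>The intermediate eigenfunction, that of the conjugate of g by w, is inserted and
  cancels. One of the two resulting products is then transported from the cycles of g to those of
  the conjugate.\<close>

lemma alpha_comp:
  assumes v: "v \<in> perms" and w: "w \<in> perms" and g: "g \<in> perms"
  shows "alpha (v \<circ> w) g = alpha v (w \<circ> g \<circ> inv' w) * alpha w g"
proof -
  define h where "h = w \<circ> g \<circ> inv' w"
  have h: "h \<in> perms"
    unfolding h_def using w g by (rule perms_conjugate)
  have conj: "(v \<circ> w) \<circ> g \<circ> inv' (v \<circ> w) = v \<circ> h \<circ> inv' v"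
    using perms_bij[OF v] perms_bij[OF w] by (simp add: h_def o_inv_distrib comp_assoc)
  have "alpha (v \<circ> w) g = orbit_prod g {1..n}
      (\<lambda>x. (theta (v \<circ> h \<circ> inv' v) (v (w x)) / theta h (w x)) * (theta h (w x) / theta g x))"
    unfolding alpha_def conj by simp
  also have "\<dots> = orbit_prod g {1..n} (\<lambda>x. theta (v \<circ> h \<circ> inv' v) (v (w x)) / theta h (w x)) * alpha w g"
    unfolding alpha_def h_def[symmetric] by (rule orbit_prod_mult)
  also have "orbit_prod g {1..n} (\<lambda>x. theta (v \<circ> h \<circ> inv' v) (v (w x)) / theta h (w x))
      = orbit_prod h (w ` {1..n}) (\<lambda>x. theta (v \<circ> h \<circ> inv' v) (v x) / theta h x)"
  proof -
    have "invariant_on (w \<circ> g \<circ> inv' w) (w ` {1..n}) (\<lambda>x. theta (v \<circ> h \<circ> inv' v) (v x) / theta h x)"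
      unfolding perms_image[OF w] h_def[symmetric] by (rule invariant_on_theta_ratio[OF v h])
    then show ?thesis
      unfolding h_def using perms_in[OF g]
      by (intro orbit_prod_transport[OF perms_permutation[OF g] perms_bij[OF w] _ _ perms_permutation[OF w], symmetric]) blast+
  qed
  finally show ?thesis
    unfolding perms_image[OF w] alpha_def h_def .
qed

lemma alpha_id: "alpha id g = 1"
  by (simp add: alpha_def orbit_prod_def)

text \<open>Two eigenfunctions of g differ by a factor \<mu> that is constant on cycles. As w
  permutes the cycles of g, the product of \<mu>(w x) over them equals that of \<mu>(x), so \<mu>
  drops out.\<close>

lemma alpha_commuting:
  assumes w: "w \<in> perms" and g: "g \<in> perms" and comm: "g \<circ> w = w \<circ> g"
    and \<theta>: "eigenfun \<theta> g {1..n}"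
  shows "alpha w g = orbit_prod g {1..n} (\<lambda>x. \<theta> (w x) / \<theta> x)"
proof -
  note perm = perms_permutation[OF g]
  define \<mu> where "\<mu> x = theta g x / \<theta> x" for x
  have inv: "invariant_on g {1..n} \<mu>"
    unfolding invariant_on_def \<mu>_def using \<theta>
    by (simp add: eigenfun_def theta_step[OF perm] del: atLeastAtMost_iff)
  have conj: "w \<circ> g \<circ> inv' w = g"
    using perms_bij[OF w] comm by (rule conjugate_eq_self)
  have nz: "\<theta> x \<noteq> 0" "\<theta> (w x) \<noteq> 0" if "x \<in> {1..n}" for x
    using \<theta> that perms_in[OF w, of x] by (auto simp: eigenfun_def simp del: atLeastAtMost_iff)
  have "alpha w g = orbit_prod g {1..n} (\<lambda>x. \<theta> (w x) / \<theta> x * (\<mu> (w x) / \<mu> x))"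
    unfolding alpha_def using invariant_on_theta_ratio[OF w g] nz
    by (intro orbit_prod_cong[OF perm]) (simp_all add: conj \<mu>_def)
  also have "\<dots> = orbit_prod g {1..n} (\<lambda>x. \<theta> (w x) / \<theta> x)
      * (orbit_prod g {1..n} (\<lambda>x. \<mu> (w x)) / orbit_prod g {1..n} \<mu>)"
    by (simp only: orbit_prod_mult orbit_prod_divide)
  also have "orbit_prod g {1..n} (\<lambda>x. \<mu> (w x)) = orbit_prod g {1..n} \<mu>"
    using orbit_prod_transport[OF perm perms_bij[OF w] _ _ perms_permutation[OF w], of "{1..n}" \<mu>]
      inv perms_in[OF g]
    unfolding conj perms_image[OF w] by simp
  also have "orbit_prod g {1..n} \<mu> \<noteq> 0"
  proof -
    have "Min c \<in> {1..n}" if "c \<in> orbit g ` {1..n}" for c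
      using that invariant_on_orbit[OF inv _ Min_orbit_in[OF perm]] by blast
    then show ?thesis
      unfolding orbit_prod_def \<mu>_def using nz(1) by (auto simp del: atLeastAtMost_iff)
  qed
  ultimately show ?thesis
    by simp
qed

text \<open>Conjugation by w fixes g, so the cocycle identity becomes multiplicativity along the
  powers of w.\<close>

lemma alpha_funpow:
  assumes w: "w \<in> perms" and g: "g \<in> perms" and comm: "g \<circ> w = w \<circ> g"
  shows "alpha (w ^^ i) g = alpha w g ^ i"
proof (induction i)
  case 0
  show ?case
    using alpha_id by (simp add: id_def)
next
  case (Suc i)
  have conj: "w \<circ> g \<circ> inv' w = g"
    using perms_bij[OF w] comm by (rule conjugate_eq_self)
  have "w ^^ i \<in> perms"
    using w by (simp add: permutes_funpow)
  then have "alpha (w ^^ i \<circ> w) g = alpha w g ^ i * alpha w g"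
    using w g by (simp add: alpha_comp conj Suc.IH)
  then show ?case
    by (simp only: funpow_Suc_right power_Suc2)
qed

lemma alpha_power_M:
  assumes w: "w \<in> perms" and g: "g \<in> perms"
  shows "alpha w g ^ M = 1"
  unfolding alpha_def orbit_prod_def prod_power_distrib
proof (rule prod.neutral, rule ballI)
  fix c assume "c \<in> orbit g ` {1..n}"
  then have "Min c \<in> {1..n}"
    using invariant_on_orbit[OF invariant_on_theta_ratio[OF w g] _ Min_orbit_in[OF perms_permutation[OF g]]] by blast
  then have "theta g (Min c) ^ M = 1" "theta (w \<circ> g \<circ> inv' w) (w (Min c)) ^ M = 1"
    using theta_power_M[OF g] theta_power_M[OF perms_conjugate[OF w g]] perms_in[OF w] by blast+
  then show "(theta (w \<circ> g \<circ> inv' w) (w (Min c)) / theta g (Min c)) ^ M = 1"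
    by (simp add: power_divide)
qed

lemma alpha_eq_1:
  assumes w: "w \<in> perms" and g: "g \<in> perms" and comm: "g \<circ> w = w \<circ> g"
    and K: "w ^^ K = id" "coprime K M" "K > 0"
  shows "alpha w g = 1"
proof (rule power_eq_1_coprime[OF _ alpha_power_M[OF w g] K(2,3)])
  show "alpha w g ^ K = 1"
    using alpha_funpow[OF w g comm, of K] alpha_id by (simp add: K(1))
qed

end

section \<open>Vanishing of the trace at elements with a bad cycle\<close>

lemma in_orbit_iff: "permutation f \<Longrightarrow> y \<in> orbit f x \<longleftrightarrow> orbit f y = orbit f x"
  using orbit_eq_permutation permutation_self_in_orbit by metis

section \<open>Commuting permutations and a single cycle of one of them\<close>

definition joint_orbit :: "('a \<Rightarrow> 'a) \<Rightarrow> ('a \<Rightarrow> 'a) \<Rightarrow> 'a \<Rightarrow> 'a set"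
  where "joint_orbit g w x = (\<Union>i j. {(g ^^ i) ((w ^^ j) x)})"

lemma joint_orbit_base: "x \<in> joint_orbit g w x"
proof -
  have "x = (g ^^ 0) ((w ^^ 0) x)"
    by simp
  then show ?thesis
    unfolding joint_orbit_def by blast
qed

lemma joint_orbit_left: "y \<in> joint_orbit g w x \<Longrightarrow> g y \<in> joint_orbit g w x"
proof -
  assume "y \<in> joint_orbit g w x"
  then obtain i j where "y = (g ^^ i) ((w ^^ j) x)"
    by (auto simp: joint_orbit_def)
  then have "g y = (g ^^ Suc i) ((w ^^ j) x)"
    by simp
  then show ?thesis
    unfolding joint_orbit_def by blast
qed

lemma joint_orbit_right:
  assumes "g \<circ> w = w \<circ> g" "y \<in> joint_orbit g w x"
  shows "w y \<in> joint_orbit g w x"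
proof -
  obtain i j where "y = (g ^^ i) ((w ^^ j) x)"
    using assms(2) by (auto simp: joint_orbit_def)
  then have "w y = (g ^^ i) ((w ^^ Suc j) x)"
    using funpow_commute[OF assms(1)[symmetric]] by simp
  then show ?thesis
    unfolding joint_orbit_def by blast
qed

lemma joint_orbit_least:
  assumes "x \<in> X" "\<And>y. y \<in> X \<Longrightarrow> g y \<in> X" "\<And>y. y \<in> X \<Longrightarrow> w y \<in> X"
  shows "joint_orbit g w x \<subseteq> X"
  unfolding joint_orbit_def using assms by (auto intro!: funpow_in_closed)

definition cycle_at :: "('a \<Rightarrow> 'a) \<Rightarrow> 'a \<Rightarrow> 'a \<Rightarrow> 'a"
  where "cycle_at w x y = (if y \<in> orbit w x then w y else y)"

lemma apply_in_orbit_iff: "permutation w \<Longrightarrow> w y \<in> orbit w x \<longleftrightarrow> y \<in> orbit w x"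
  by (simp add: in_orbit_iff orbit_apply_permutation)

lemma funpow_in_orbit_iff: "permutation w \<Longrightarrow> (w ^^ i) y \<in> orbit w x \<longleftrightarrow> y \<in> orbit w x"
  by (simp add: in_orbit_iff orbit_funpow_permutation)

lemma cycle_at_commute: "permutation w \<Longrightarrow> cycle_at w x \<circ> w = w \<circ> cycle_at w x"
  by (auto simp: cycle_at_def apply_in_orbit_iff fun_eq_iff)

lemma cycle_at_permutes:
  assumes w: "w permutes S" and "finite S"
  shows "cycle_at w x permutes S"
proof (rule inj_imp_permutes)
  have perm: "permutation w"
    using assms permutation_permutes by blast
  show "inj_on (cycle_at w x) S"
  proof (rule inj_onI)
    fix a b assume ab: "cycle_at w x a = cycle_at w x b"
    then have "a \<in> orbit w x \<longleftrightarrow> b \<in> orbit w x"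
      using apply_in_orbit_iff[OF perm] by (metis cycle_at_def)
    then show "a = b"
      using ab permutes_inj[OF w] by (auto simp: cycle_at_def inj_eq split: if_splits)
  qed
  show "cycle_at w x y \<in> S" if "y \<in> S" for y
    using that permutes_in_image[OF w] by (simp add: cycle_at_def)
  show "cycle_at w x y = y" if "y \<notin> S" for y
    using permutes_not_in[OF w that] by (simp add: cycle_at_def)
qed fact

lemma funpow_add_apply: "(f ^^ a) ((f ^^ b) x) = (f ^^ (a + b)) x"
  by (simp add: funpow_add)

lemma cycle_at_funpow_outside: "y \<notin> orbit w x \<Longrightarrow> (cycle_at w x ^^ t) y = y"
  by (induction t) (auto simp: cycle_at_def)

lemma cycle_at_funpow_inside:
  assumes "permutation w" "y \<in> orbit w x"
  shows "(cycle_at w x ^^ t) y = (w ^^ t) y"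
  by (induction t) (use assms in \<open>auto simp: cycle_at_def funpow_in_orbit_iff\<close>)

text \<open>This supplies inverses by forward iteration: with k the cycle length, the exponent t *
  (k - 1) undoes the exponent t.\<close>

lemma cycle_at_funpow_card:
  assumes "permutation w" "card (orbit w x) dvd i"
  shows "cycle_at w x ^^ i = id"
proof
  fix y
  show "(cycle_at w x ^^ i) y = id y"
  proof (cases "y \<in> orbit w x")
    case True
    then show ?thesis
      using assms orbit_eq_permutation[OF assms(1) True]
      by (simp add: cycle_at_funpow_inside funpow_eq_self_iff_dvd)
  qed (simp add: cycle_at_funpow_outside)
qed

text \<open>
  Right multiplication of \<open>g\<close> by powers of the \<open>w\<close>-cycle \<open>h\<close> through \<open>x0\<close> changes \<open>g\<close> only
  on the orbit \<open>J\<close> of \<open>x0\<close> under $\langle g, w \rangle$. If \<open>m\<close> is the number of \<open>w\<close>-cycles in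
  \<open>J\<close>, then \<open>(G t) ^^ m\<close> acts on \<open>J\<close> as \<open>w ^^ (t + t0)\<close>, so \<open>G t\<close> has \<open>b = gcd (t + t0) k\<close>
  cycles in \<open>J\<close>, and the contribution of \<open>J\<close> to \<open>alpha w (G t)\<close> is read off from the power of
  \<open>G t\<close> that agrees with \<open>w ^^ b\<close>.
\<close>

locale twisted_commuting_pair = coprime_split +
  fixes w g :: "nat \<Rightarrow> nat" and x0 :: nat
  assumes w: "w \<in> perms" and g: "g \<in> perms" and comm: "g \<circ> w = w \<circ> g"
    and x0: "x0 \<in> {1..n}"
begin

abbreviation "h \<equiv> cycle_at w x0"
abbreviation "k \<equiv> card (orbit w x0)"
definition "G t = g \<circ> h ^^ t"

lemma perm_w: "permutation w" and perm_g: "permutation g"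
  using w g by (auto intro: perms_permutation)

lemma k_pos: "k > 0"
  by (rule card_orbit_pos[OF perm_w])

lemma G_perms: "G t \<in> perms"
  using g w by (auto simp: G_def intro!: permutes_compose permutes_funpow cycle_at_permutes)

lemma perm_G: "permutation (G t)"
  using G_perms by (rule perms_permutation)

lemma G_w_commute: "G t \<circ> w = w \<circ> G t"
proof
  fix y
  show "(G t \<circ> w) y = (w \<circ> G t) y"
    using funpow_commute[OF cycle_at_commute[OF perm_w, symmetric], of t x0 y]
      fun_cong[OF comm, of "(h ^^ t) y"] by (simp add: G_def)
qed

lemma G_outside: "y \<notin> orbit w x0 \<Longrightarrow> G t y = g y"
  by (simp add: G_def cycle_at_funpow_outside)

lemma G_x0: "G t ((w ^^ j) x0) = (w ^^ (t + j)) (g x0)"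
proof -
  have "(w ^^ j) x0 \<in> orbit w x0"
    by (simp add: funpow_in_orbit_iff perm_w permutation_self_in_orbit)
  then have "G t ((w ^^ j) x0) = g ((w ^^ (t + j)) x0)"
    by (simp add: G_def cycle_at_funpow_inside perm_w funpow_add)
  then show ?thesis
    by (simp add: funpow_commute[OF comm])
qed

text \<open>Since g commutes with w, it permutes the w-cycles inside the joint orbit cyclically;
  \<open>m\<close> is the number of steps until it returns to the cycle of x0.\<close>

definition "m = (LEAST i. 0 < i \<and> (g ^^ i) x0 \<in> orbit w x0)"

lemma m_pos: "m > 0" and m_in: "(g ^^ m) x0 \<in> orbit w x0"
  and m_least: "0 < i \<Longrightarrow> i < m \<Longrightarrow> (g ^^ i) x0 \<notin> orbit w x0"
proof -
  have "(g ^^ card (orbit g x0)) x0 = x0"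
    by (simp add: funpow_eq_self_iff_dvd perm_g)
  then have "0 < card (orbit g x0) \<and> (g ^^ card (orbit g x0)) x0 \<in> orbit w x0"
    using permutation_self_in_orbit[OF perm_w, of x0] card_orbit_pos[OF perm_g, of x0] by simp
  from LeastI[of "\<lambda>i. 0 < i \<and> (g ^^ i) x0 \<in> orbit w x0", OF this]
  show "m > 0" "(g ^^ m) x0 \<in> orbit w x0"
    by (auto simp: m_def)
  show "0 < i \<Longrightarrow> i < m \<Longrightarrow> (g ^^ i) x0 \<notin> orbit w x0"
    using not_less_Least[of i "\<lambda>i. 0 < i \<and> (g ^^ i) x0 \<in> orbit w x0"] by (auto simp: m_def)
qed

text \<open>After these \<open>m\<close> steps g rotates the w-cycle of x0 by
  \<open>t0\<close>.\<close>

definition "t0 = (SOME t. (g ^^ m) x0 = (w ^^ t) x0)"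

lemma t0: "(g ^^ m) x0 = (w ^^ t0) x0"
proof -
  have "\<exists>t. (g ^^ m) x0 = (w ^^ t) x0"
    using m_in by (auto simp: orbit_altdef_permutation[OF perm_w])
  then show ?thesis
    unfolding t0_def by (rule someI_ex)
qed

text \<open>The factor h^t acts only at the first step: the following points lie on other w-cycles
  until step \<open>m\<close>. One full round thus adds t exactly once to the rotation.\<close>

lemma G_funpow_le:
  assumes "0 < i" "i \<le> m"
  shows "(G t ^^ i) ((w ^^ j) x0) = (w ^^ (t + j)) ((g ^^ i) x0)"
  using assms
proof (induction i)
  case (Suc i)
  show ?case
  proof (cases "i = 0")
    case True
    then show ?thesis
      by (simp add: G_x0)
  next
    case False
    then have "(w ^^ (t + j)) ((g ^^ i) x0) \<notin> orbit w x0"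
      using m_least[of i] Suc.prems by (simp add: funpow_in_orbit_iff perm_w)
    then show ?thesis
      using False Suc by (simp add: G_outside funpow_commute[OF comm])
  qed
qed simp

lemma G_funpow_m: "(G t ^^ m) ((w ^^ j) x0) = (w ^^ (t + t0 + j)) x0"
proof -
  have "(G t ^^ m) ((w ^^ j) x0) = (w ^^ (t + j)) ((w ^^ t0) x0)"
    using G_funpow_le[of m t j] m_pos by (simp only: t0 le_refl)
  also have "\<dots> = (w ^^ (t + j + t0)) x0"
    by (rule funpow_add_apply)
  finally show ?thesis
    by (simp only: add_ac)
qed

lemma G_funpow_mult_m: "(G t ^^ (m * q)) ((w ^^ j) x0) = (w ^^ ((t + t0) * q + j)) x0"
proof (induction q)
  case (Suc q)
  have "(G t ^^ (m * Suc q)) ((w ^^ j) x0) = (G t ^^ m) ((G t ^^ (m * q)) ((w ^^ j) x0))"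
    by (simp add: funpow_add)
  also have "\<dots> = (w ^^ ((t + t0) * Suc q + j)) x0"
    unfolding Suc.IH G_funpow_m by (simp add: algebra_simps)
  finally show ?case .
qed simp

lemma G_funpow_in_orbit: "(G t ^^ s) x0 \<in> orbit w x0 \<longleftrightarrow> m dvd s"
proof -
  have "(G t ^^ s) x0 = (G t ^^ (s mod m)) ((G t ^^ (m * (s div m))) ((w ^^ 0) x0))"
    by (simp add: funpow_add_apply)
  also have "\<dots> = (G t ^^ (s mod m)) ((w ^^ ((t + t0) * (s div m))) x0)"
    unfolding G_funpow_mult_m by simp
  finally have eq: "(G t ^^ s) x0 = \<dots>" .
  show ?thesis
  proof (cases "s mod m = 0")
    case True
    then show ?thesis
      unfolding eq by (simp add: funpow_in_orbit_iff perm_w permutation_self_in_orbit mod_eq_0_iff_dvd)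
  next
    case False
    then show ?thesis
      unfolding eq using G_funpow_le[of "s mod m" t] m_least[of "s mod m"] m_pos
      by (simp add: funpow_in_orbit_iff perm_w mod_eq_0_iff_dvd[symmetric])
  qed
qed

text \<open>A cycle of \<open>G t\<close> revisits the w-cycle of x0 every \<open>m\<close> steps,
  each time rotated by t + t0, and the multiples of t + t0 modulo k are those of the gcd.\<close>

lemma funpow_in_G_orbit: "(w ^^ i) x0 \<in> orbit (G t) x0 \<longleftrightarrow> gcd (t + t0) k dvd i"
proof
  assume "(w ^^ i) x0 \<in> orbit (G t) x0"
  then obtain s where s: "(w ^^ i) x0 = (G t ^^ s) x0"
    by (auto simp: orbit_altdef_permutation[OF perm_G])
  then have "m dvd s"
    by (subst G_funpow_in_orbit[where t = t, symmetric])
      (simp add: s[symmetric] funpow_in_orbit_iff perm_w permutation_self_in_orbit)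
  then obtain q where "s = m * q" ..
  then have "(w ^^ i) x0 = (w ^^ ((t + t0) * q)) x0"
    using s G_funpow_mult_m[where t = t and q = q and j = 0] by simp
  then have "[i = (t + t0) * q] (mod k)"
    by (simp add: funpow_eq_iff_cong[OF perm_w])
  then show "gcd (t + t0) k dvd i"
    using cong_dvd_iff[OF cong_dvd_modulus_nat, of i "(t + t0) * q" k "gcd (t + t0) k"] by simp
next
  assume "gcd (t + t0) k dvd i"
  then obtain c where c: "i = gcd (t + t0) k * c" ..
  obtain u where "[u * (t + t0) = gcd (t + t0) k] (mod k)"
    using ex_mult_cong_gcd[OF k_pos] by blast
  then have "[u * (t + t0) * c = i] (mod k)"
    unfolding c by (rule cong_scalar_right)
  then have "(w ^^ (u * (t + t0) * c)) x0 = (w ^^ i) x0"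
    by (simp add: funpow_eq_iff_cong[OF perm_w])
  then have "(w ^^ i) x0 = (G t ^^ (m * (u * c))) x0"
    using G_funpow_mult_m[where t = t and q = "u * c" and j = 0] by (simp add: mult_ac)
  then show "(w ^^ i) x0 \<in> orbit (G t) x0"
    by (auto simp: orbit_altdef_permutation[OF perm_G])
qed

text \<open>The return time to x0 is \<open>m\<close> times the additive order of t + t0 modulo k,
  which is k divided by the gcd.\<close>

lemma card_G_orbit: "card (orbit (G t) x0) * gcd (t + t0) k = m * k"
proof -
  obtain T' d where T': "t + t0 = T' * gcd (t + t0) k" and d: "k = d * gcd (t + t0) k" and cop: "coprime T' d"
    using gcd_coprime_exists[of "t + t0" k] k_pos by auto
  define b where "b = gcd (t + t0) k"
  have b: "b > 0"
    using k_pos by (simp add: b_def)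
  have "card (orbit (G t) x0) = m * d"
  proof (rule dvd_antisym)
    have "k dvd (t + t0) * d"
      using T' d by (metis dvd_triv_right mult.assoc mult.commute)
    then have "(G t ^^ (m * d)) x0 = x0"
      using G_funpow_mult_m[where t = t and q = d and j = 0] by (simp add: funpow_eq_self_iff_dvd[OF perm_w])
    then show "card (orbit (G t) x0) dvd m * d"
      by (simp add: funpow_eq_self_iff_dvd[OF perm_G])
    have self: "(G t ^^ card (orbit (G t) x0)) x0 = x0"
      by (simp add: funpow_eq_self_iff_dvd[OF perm_G])
    then have "m dvd card (orbit (G t) x0)"
      by (subst G_funpow_in_orbit[where t = t, symmetric]) (simp add: permutation_self_in_orbit perm_w)
    then obtain q where q: "card (orbit (G t) x0) = m * q" ..
    have "(w ^^ ((t + t0) * q)) x0 = x0"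
      using self G_funpow_mult_m[where t = t and q = q and j = 0] by (simp add: q)
    then have "k dvd (t + t0) * q"
      by (simp add: funpow_eq_self_iff_dvd[OF perm_w])
    then have "d * b dvd (T' * b) * q"
      using T' d unfolding b_def[symmetric] by simp
    then have "b * d dvd b * (T' * q)"
      by (simp add: mult_ac)
    then have "d dvd T' * q"
      using b by simp
    then have "d dvd q"
      using cop by (simp add: coprime_commute coprime_dvd_mult_right_iff)
    then show "m * d dvd card (orbit (G t) x0)"
      by (simp add: q)
  qed
  then show ?thesis
    using d by (metis mult.assoc)
qed

end

context coprime_split
begin

lemma perms_closed_iff:
  assumes p: "p \<in> perms" and X: "X \<subseteq> {1..n}" and cl: "\<And>x. x \<in> X \<Longrightarrow> p x \<in> X"
  shows "p x \<in> X \<longleftrightarrow> x \<in> X"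
proof -
  have inj: "inj p"
    using perms_bij[OF p] by (rule bij_is_inj)
  have "finite X"
    using X by (rule finite_subset) simp
  then have "p ` X = X"
    using cl inj by (intro endo_inj_surj) (auto intro: inj_on_subset)
  then show ?thesis
    using inj by (metis imageE imageI inj_eq)
qed

lemma theta_funpow:
  assumes "permutation g"
  shows "theta g ((g ^^ i) x) = zeta (card (orbit g x)) ^ i * theta g x"
  by (induction i) (use assms in \<open>simp_all add: theta_step orbit_funpow_permutation\<close>)

end

section \<open>Splitting alpha along the joint orbit\<close>

context twisted_commuting_pair
begin

definition "J = joint_orbit g w x0"

lemma J_base: "x0 \<in> J"
  unfolding J_def by (rule joint_orbit_base)

lemma J_subset: "J \<subseteq> {1..n}"
  unfolding J_def using x0 perms_in[OF g] perms_in[OF w] by (intro joint_orbit_least) blast+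

lemma J_w: "w y \<in> J \<longleftrightarrow> y \<in> J"
  using J_subset joint_orbit_right[OF comm] by (intro perms_closed_iff[OF w]) (auto simp: J_def)

lemma J_g: "g y \<in> J \<longleftrightarrow> y \<in> J"
  using J_subset joint_orbit_left by (intro perms_closed_iff[OF g]) (auto simp: J_def)

lemma cycle_at_closed: "(\<And>y. y \<in> X \<Longrightarrow> w y \<in> X) \<Longrightarrow> y \<in> X \<Longrightarrow> (h ^^ t) y \<in> X"
  by (rule funpow_in_closed) (auto simp: cycle_at_def)

lemma G_closed_J: "y \<in> J \<Longrightarrow> G t y \<in> J"
  using cycle_at_closed[of J y t] by (simp add: G_def J_g J_w)

lemma J_G: "G t y \<in> J \<longleftrightarrow> y \<in> J"
  using J_subset G_closed_J by (intro perms_closed_iff[OF G_perms])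

text \<open>Since g is \<open>G t\<close> times an inverse power of \<open>h\<close>, the orbit does
  not change; its points can now be reached by powers of \<open>G t\<close> and w.\<close>

lemma J_eq: "J = joint_orbit (G t) w x0"
proof
  let ?J = "joint_orbit (G t) w x0"
  show "joint_orbit (G t) w x0 \<subseteq> J"
    using J_base G_closed_J by (intro joint_orbit_least) (simp_all add: J_w)
  show "J \<subseteq> ?J"
    unfolding J_def
  proof (rule joint_orbit_least[OF joint_orbit_base])
    show wcl: "w y \<in> ?J" if "y \<in> ?J" for y
      using that by (rule joint_orbit_right[OF G_w_commute])
    show "g y \<in> ?J" if y: "y \<in> ?J" for y
    proof -
      have "t + t * (k - 1) = k * t"
        using k_pos by (simp add: diff_mult_distrib2 mult.commute)
      then have "(h ^^ t) ((h ^^ (t * (k - 1))) y) = y"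
        by (simp add: funpow_add_apply cycle_at_funpow_card perm_w)
      then have "g y = G t ((h ^^ (t * (k - 1))) y)"
        by (simp add: G_def)
      then show ?thesis
        using joint_orbit_left[OF cycle_at_closed[of ?J, OF wcl y]] by simp
    qed
  qed
qed

lemma orbit_J: "orbit w x0 \<subseteq> J"
  using J_base by (intro orbit_subset_closed) (simp_all add: J_w)

lemma G_outside_J: "y \<notin> J \<Longrightarrow> G t y = g y"
  using orbit_J by (intro G_outside) blast

lemma orbit_G_outside_J:
  assumes "y \<notin> J"
  shows "orbit (G t) y = orbit g y"
proof -
  have "(g ^^ i) y \<notin> J" for i
    using assms by (induction i) (simp_all add: J_g)
  then have "(G t ^^ i) y = (g ^^ i) y" for i
    by (induction i) (simp_all add: G_outside_J)
  then show ?thesis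
    by (simp add: orbit_altdef)
qed

text \<open>The eigenfunction is glued from two pieces: off \<open>J\<close>, where
  \<open>G t\<close> agrees with g, that of g is kept. This makes the outside factor of
  \<open>alpha\<close> visibly independent of t.\<close>

definition "eta t y = (if y \<in> J then theta (G t) y else theta g y)"

lemma eigenfun_eta: "eigenfun (eta t) (G t) {1..n}"
  unfolding eigenfun_def
proof (intro ballI conjI)
  fix y assume y: "y \<in> {1..n}"
  show "G t y \<in> {1..n}"
    using y perms_in[OF G_perms] by blast
  show "eta t y \<noteq> 0"
    by (simp add: eta_def)
  show "eta t (G t y) = zeta (card (orbit (G t) y)) * eta t y"
    by (simp add: eta_def J_G theta_step perm_G perm_g G_outside_J orbit_G_outside_J J_g)
qed

lemma orbit_prod_G_outside:
  "orbit_prod (G t) ({1..n} - J) (\<lambda>y. eta t (w y) / eta t y)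
    = orbit_prod g ({1..n} - J) (\<lambda>y. theta g (w y) / theta g y)"
proof -
  have im: "orbit (G t) ` ({1..n} - J) = orbit g ` ({1..n} - J)"
    by (intro image_cong refl orbit_G_outside_J) blast
  have "Min c \<notin> J" if c: "c \<in> orbit g ` ({1..n} - J)" for c
  proof -
    obtain y where y: "y \<notin> J" "c = orbit g y"
      using c by blast
    have "orbit g y \<subseteq> - J"
      using y(1) by (intro orbit_subset_closed) (simp_all add: J_g)
    then show ?thesis
      using Min_orbit_in[OF perm_g] y(2) by blast
  qed
  then show ?thesis
    unfolding orbit_prod_def im by (intro prod.cong refl) (simp add: eta_def J_w)
qed

text \<open>The points x0, w x0, ..., up to exponent \<open>gcd (t + t0) k - 1\<close>, represent
  the cycles of \<open>G t\<close> in \<open>J\<close> once each: every point of \<open>J\<close> is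
  a power of \<open>G t\<close> applied to some iterate of x0 under w, and that iterate matters only
  modulo the gcd.\<close>

lemma orbit_G_J: "orbit (G t) ` J = (\<lambda>i. orbit (G t) ((w ^^ i) x0)) ` {..<gcd (t + t0) k}"
  and orbit_G_J_inj: "inj_on (\<lambda>i. orbit (G t) ((w ^^ i) x0)) {..<gcd (t + t0) k}"
proof -
  define b where "b = gcd (t + t0) k"
  have b: "b > 0"
    using k_pos by (simp add: b_def)
  have in_b: "(w ^^ i) x0 \<in> orbit (G t) x0 \<longleftrightarrow> b dvd i" for i
    unfolding b_def by (rule funpow_in_G_orbit)
  have shift: "(w ^^ (i + j)) x0 \<in> orbit (G t) ((w ^^ i) x0)" if j: "b dvd j" for i j
  proof -
    obtain s where "(w ^^ j) x0 = (G t ^^ s) x0"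
      using in_b[of j] j by (auto simp: orbit_altdef_permutation[OF perm_G])
    then have "(w ^^ (i + j)) x0 = (w ^^ i) ((G t ^^ s) x0)"
      by (simp add: funpow_add)
    also have "\<dots> = (G t ^^ s) ((w ^^ i) x0)"
    proof (induction s)
      case (Suc s)
      then show ?case
        using funpow_commute[OF G_w_commute, of t i, symmetric] by simp
    qed simp
    finally show ?thesis
      by (auto simp: orbit_altdef_permutation[OF perm_G])
  qed
  have "orbit (G t) y \<in> (\<lambda>i. orbit (G t) ((w ^^ i) x0)) ` {..<b}" if yJ: "y \<in> J" for y
  proof -
    obtain s j where y: "y = (G t ^^ s) ((w ^^ j) x0)"
      using yJ unfolding J_eq[of t] by (auto simp: joint_orbit_def)
    have "(w ^^ (j mod b + b * (j div b))) x0 \<in> orbit (G t) ((w ^^ (j mod b)) x0)"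
      by (rule shift) simp
    then have "(w ^^ j) x0 \<in> orbit (G t) ((w ^^ (j mod b)) x0)"
      by simp
    then have "orbit (G t) y = orbit (G t) ((w ^^ (j mod b)) x0)"
      by (simp add: y orbit_funpow_permutation perm_G in_orbit_iff)
    then show ?thesis
      using b by auto
  qed
  moreover have "(w ^^ i) x0 \<in> J" for i
    by (rule funpow_in_closed) (simp_all add: J_w J_base)
  ultimately show "orbit (G t) ` J = (\<lambda>i. orbit (G t) ((w ^^ i) x0)) ` {..<gcd (t + t0) k}"
    unfolding b_def[symmetric] by blast
  have *: "i = j" if ij: "i \<le> j" "j < b" and eq: "orbit (G t) ((w ^^ i) x0) = orbit (G t) ((w ^^ j) x0)" for i j
  proof -
    have "(w ^^ j) x0 \<in> orbit (G t) ((w ^^ i) x0)"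
      by (simp add: eq permutation_self_in_orbit perm_G)
    then obtain s where "(w ^^ j) x0 = (G t ^^ s) ((w ^^ i) x0)"
      by (auto simp: orbit_altdef_permutation[OF perm_G])
    also have "\<dots> = (w ^^ i) ((G t ^^ s) x0)"
    proof (induction s)
      case (Suc s)
      then show ?case
        using funpow_commute[OF G_w_commute, of t i] by simp
    qed simp
    finally have "(w ^^ i) ((w ^^ (j - i)) x0) = (w ^^ i) ((G t ^^ s) x0)"
      using ij(1) by (simp add: funpow_add_apply)
    then have "(w ^^ (j - i)) x0 = (G t ^^ s) x0"
      using inj_fn[OF bij_is_inj[OF perms_bij[OF w]], of i] by (simp add: inj_eq)
    then have "b dvd j - i"
      using in_b[of "j - i"] by (auto simp: orbit_altdef_permutation[OF perm_G])
    then show "i = j"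
      using ij by (auto dest: dvd_imp_le)
  qed
  show "inj_on (\<lambda>i. orbit (G t) ((w ^^ i) x0)) {..<gcd (t + t0) k}"
    unfolding b_def[symmetric]
  proof (rule inj_onI)
    fix i j assume "i \<in> {..<b}" "j \<in> {..<b}" "orbit (G t) ((w ^^ i) x0) = orbit (G t) ((w ^^ j) x0)"
    then show "i = j"
      using *[of i j] *[of j i] by (cases "i \<le> j") auto
  qed
qed

text \<open>Evaluated at the points w^i x0 instead of the least points, the product telescopes to
  theta(w^b x0) / theta(x0) with b the gcd. The congruence for u turns w^b x0 into an iterate of
  \<open>G t\<close> at x0, so the quotient is a power of the root of that cycle.\<close>

lemma orbit_prod_G_J:
  assumes u: "[u * (t + t0) = gcd (t + t0) k] (mod k)"
  shows "orbit_prod (G t) J (\<lambda>y. eta t (w y) / eta t y) = zeta k ^ (gcd (t + t0) k * u)"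
proof -
  define b where "b = gcd (t + t0) k"
  define \<phi> where "\<phi> y = theta (G t) (w y) / theta (G t) y" for y
  have inv: "invariant_on (G t) {1..n} \<phi>"
    using invariant_on_theta_ratio[OF w G_perms, of t] conjugate_eq_self[OF perms_bij[OF w] G_w_commute, of t]
    unfolding \<phi>_def by simp
  have wJ: "(w ^^ i) x0 \<in> J" for i
    by (rule funpow_in_closed) (simp_all add: J_w J_base)
  have "orbit_prod (G t) J (\<lambda>y. eta t (w y) / eta t y)
      = (\<Prod>i<b. eta t (w (Min (orbit (G t) ((w ^^ i) x0)))) / eta t (Min (orbit (G t) ((w ^^ i) x0))))"
    unfolding orbit_prod_def orbit_G_J b_def by (subst prod.reindex[OF orbit_G_J_inj]) simp
  also have "\<dots> = (\<Prod>i<b. theta (G t) ((w ^^ Suc i) x0) / theta (G t) ((w ^^ i) x0))"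
  proof (rule prod.cong[OF refl])
    fix i
    have "orbit (G t) ((w ^^ i) x0) \<subseteq> J"
      by (rule orbit_subset_closed) (simp_all add: J_G wJ)
    then have "Min (orbit (G t) ((w ^^ i) x0)) \<in> J"
      using Min_orbit_in[OF perm_G] by blast
    moreover have "\<phi> (Min (orbit (G t) ((w ^^ i) x0))) = \<phi> ((w ^^ i) x0)"
      using wJ J_subset by (intro invariant_on_Min_orbit[OF perm_G inv]) blast
    ultimately show "eta t (w (Min (orbit (G t) ((w ^^ i) x0)))) / eta t (Min (orbit (G t) ((w ^^ i) x0)))
        = theta (G t) ((w ^^ Suc i) x0) / theta (G t) ((w ^^ i) x0)"
      by (simp add: eta_def J_w \<phi>_def)
  qed
  also have "\<dots> = theta (G t) ((w ^^ b) x0) / theta (G t) x0"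
    using prod_lessThan_telescope[of b "\<lambda>i. theta (G t) ((w ^^ i) x0)"] by simp
  also have "(w ^^ b) x0 = (w ^^ ((t + t0) * u)) x0"
    using cong_sym[OF u] by (simp add: funpow_eq_iff_cong[OF perm_w] b_def mult.commute)
  also have "\<dots> = (G t ^^ (m * u)) x0"
    using G_funpow_mult_m[where t = t and q = u and j = 0] by simp
  also have "theta (G t) \<dots> / theta (G t) x0 = zeta (card (orbit (G t) x0)) ^ (m * u)"
    by (simp add: theta_funpow perm_G)
  \<comment> \<open>The length of the \<open>G t\<close>-cycle times b equals \<open>m * k\<close>,
    so the two roots agree after raising to the powers m and b.\<close>
  also have "\<dots> = (zeta k ^ b) ^ u"
    unfolding power_mult using card_G_orbit[of t] card_orbit_pos[OF perm_G] k_pos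
    by (subst zeta_power_eq[of _ b m k]) (simp_all add: b_def)
  finally show ?thesis
    by (simp add: b_def power_mult)
qed

lemma alpha_G:
  assumes u: "[u * (t + t0) = gcd (t + t0) k] (mod k)"
  shows "alpha w (G t) = orbit_prod g ({1..n} - J) (\<lambda>y. theta g (w y) / theta g y)
    * zeta k ^ (gcd (t + t0) k * u)"
proof -
  have "alpha w (G t) = orbit_prod (G t) {1..n} (\<lambda>y. eta t (w y) / eta t y)"
    using w G_perms G_w_commute eigenfun_eta by (rule alpha_commuting)
  also have "{1..n} = ({1..n} - J) \<union> J"
    using J_subset by blast
  also have "orbit_prod (G t) \<dots> (\<lambda>y. eta t (w y) / eta t y)
      = orbit_prod (G t) ({1..n} - J) (\<lambda>y. eta t (w y) / eta t y)
        * orbit_prod (G t) J (\<lambda>y. eta t (w y) / eta t y)"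
    using J_subset perms_in[OF G_perms]
    by (intro orbit_prod_Un perm_G) (auto simp: J_G intro: finite_subset simp del: atLeastAtMost_iff)
  finally show ?thesis
    unfolding orbit_prod_G_outside orbit_prod_G_J[OF u] .
qed

lemma sum_alpha_G:
  assumes "\<not> k dvd M'"
  shows "(\<Sum>t<k. alpha w (G t)) = 0"
proof -
  define u where "u T = (SOME u. [u * T = gcd T k] (mod k))" for T
  have u: "[u T * T = gcd T k] (mod k)" for T
    unfolding u_def using ex_mult_cong_gcd[OF k_pos] by (rule someI_ex)
  have "(\<Sum>t<k. zeta k ^ (gcd (t + t0) k * u (t + t0))) = 0"
    using assms u by (intro sum_root_gcd_inverse k_pos zeta_power_self) (simp_all add: zeta_eq_1_iff k_pos)
  then show ?thesis
    by (simp add: alpha_G[OF u] sum_distrib_left[symmetric])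
qed

end

section \<open>Sums of alpha over a centralizer\<close>

context coprime_split
begin

definition centralizer :: "(nat \<Rightarrow> nat) \<Rightarrow> (nat \<Rightarrow> nat) set"
  where "centralizer w = {g \<in> perms. g \<circ> w = w \<circ> g}"

lemma centralizer_comp: "g \<in> centralizer w \<Longrightarrow> h \<in> centralizer w \<Longrightarrow> g \<circ> h \<in> centralizer w"
  by (auto simp: centralizer_def permutes_compose fun_eq_iff)

text \<open>Right multiplication by a power of the bad cycle permutes the centralizer. Averaging
  over the k powers therefore gives k times the sum, while the inner sum over t vanishes for each
  g.\<close>

lemma sum_alpha_eq_0:
  assumes w: "w \<in> perms" and x: "x \<in> {1..n}" and nd: "\<not> card (orbit w x) dvd M'"
  shows "(\<Sum>g\<in>centralizer w. alpha w g) = 0"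
proof -
  define k where "k = card (orbit w x)"
  have perm: "permutation w"
    using w by (rule perms_permutation)
  have k: "k > 0"
    unfolding k_def using perm by (rule card_orbit_pos)
  have h: "cycle_at w x ^^ t \<in> centralizer w" for t
  proof -
    have "cycle_at w x \<in> perms"
      using w by (auto intro: cycle_at_permutes)
    then have "cycle_at w x ^^ t \<in> perms"
      by (simp add: permutes_funpow)
    moreover have "cycle_at w x ^^ t \<circ> w = w \<circ> cycle_at w x ^^ t"
      using funpow_commute[OF cycle_at_commute[OF perm, symmetric], of t x] by (simp add: fun_eq_iff)
    ultimately show ?thesis
      by (simp add: centralizer_def)
  qed
  have id: "cycle_at w x ^^ (t * (k - 1)) \<circ> cycle_at w x ^^ t = id"
    "cycle_at w x ^^ t \<circ> cycle_at w x ^^ (t * (k - 1)) = id" for t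
  proof -
    have "t * (k - 1) + t = k * t"
      using k by (simp add: diff_mult_distrib2 mult.commute)
    then show "cycle_at w x ^^ (t * (k - 1)) \<circ> cycle_at w x ^^ t = id"
      "cycle_at w x ^^ t \<circ> cycle_at w x ^^ (t * (k - 1)) = id"
      unfolding funpow_add[symmetric] using perm by (simp_all add: cycle_at_funpow_card k_def add.commute)
  qed
  have shift: "(\<Sum>g\<in>centralizer w. alpha w (g \<circ> cycle_at w x ^^ t)) = (\<Sum>g\<in>centralizer w. alpha w g)" for t
    by (rule sum.reindex_bij_witness[where i = "\<lambda>g. g \<circ> cycle_at w x ^^ (t * (k - 1))"
          and j = "\<lambda>g. g \<circ> cycle_at w x ^^ t"])
      (simp_all add: centralizer_comp h comp_assoc id del: One_nat_def)
  have "(\<Sum>t<k. alpha w (g \<circ> cycle_at w x ^^ t)) = 0" if "g \<in> centralizer w" for g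
  proof -
    interpret twisted_commuting_pair n M M' w g x
      by unfold_locales (use that w x in \<open>auto simp: centralizer_def\<close>)
    show ?thesis
      using sum_alpha_G nd by (simp add: G_def k_def)
  qed
  then have "(\<Sum>g\<in>centralizer w. \<Sum>t<k. alpha w (g \<circ> cycle_at w x ^^ t)) = 0"
    by simp
  then have "of_nat k * (\<Sum>g\<in>centralizer w. alpha w g) = 0"
    by (subst (asm) sum.swap) (simp add: shift)
  then show ?thesis
    using k by simp
qed

lemma funpow_eq_id_of_dvd:
  assumes w: "w \<in> perms" and d: "\<And>x. x \<in> {1..n} \<Longrightarrow> card (orbit w x) dvd K"
  shows "w ^^ K = id"
proof
  fix x
  show "(w ^^ K) x = id x"
  proof (cases "x \<in> {1..n}")
    case True
    then show ?thesis
      using d[OF True] by (simp add: funpow_eq_self_iff_dvd[OF perms_permutation[OF w]])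
  next
    case False
    then have "w x = x"
      using w permutes_not_in[of w "{1..n}" x] by simp
    then show ?thesis
      by (induction K) simp_all
  qed
qed

text \<open>Here \<open>w ^^ M'\<close> is the identity, so \<open>alpha_eq_1\<close> applies with
  exponent \<open>M'\<close>, coprime to \<open>M\<close>.\<close>

lemma sum_alpha_eq_card:
  assumes w: "w \<in> perms" and d: "\<And>x. x \<in> {1..n} \<Longrightarrow> card (orbit w x) dvd M'"
  shows "(\<Sum>g\<in>centralizer w. alpha w g) = of_nat (card (centralizer w))"
proof -
  have "M' > 0"
    using fact_eq by (metis fact_nonzero mult_0_right not_gr_zero)
  then have "alpha w g = 1" if "g \<in> centralizer w" for g
    using that w coprime funpow_eq_id_of_dvd[OF w d]
    by (intro alpha_eq_1[of w g M']) (auto simp: centralizer_def coprime_commute)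
  then show ?thesis
    by simp
qed

end

section \<open>Cycle types and centralizers\<close>

lemma orbits_disjoint:
  assumes "permutation w" "c \<in> orbit w ` A" "c' \<in> orbit w ` A" "x \<in> c" "x \<in> c'"
  shows "c = c'"
  using assms by (auto simp: in_orbit_iff)

lemma Union_orbits:
  assumes "w permutes S" "finite S"
  shows "\<Union>(orbit w ` S) = S"
proof -
  have "permutation w"
    using assms permutation_permutes by blast
  then show ?thesis
    using permutes_orbit_subset[OF assms(1)] permutation_self_in_orbit by fastforce
qed

lemma set_mset_cycle_type: "set_mset (cycle_type n w) = (\<lambda>x. card (orbit w x)) ` {1..n}"
  by (auto simp: cycle_type_def)

lemma cycle_type_in_partitions:
  assumes "w permutes {1..n}"
  shows "cycle_type n w \<in> partitions n"
proof -
  have perm: "permutation w"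
    using assms permutation_permutes by blast
  have "sum_mset (cycle_type n w) = (\<Sum>c\<in>orbit w ` {1..n}. card c)"
    by (simp add: cycle_type_def sum_unfold_sum_mset)
  also have "\<dots> = card (\<Union>(orbit w ` {1..n}))"
  proof (rule card_Union_disjoint[symmetric])
    show "pairwise disjnt (orbit w ` {1..n})"
      using orbits_disjoint[OF perm] unfolding pairwise_def disjnt_def by blast
  qed (use finite_orbit_permutation[OF perm] in auto)
  also have "\<dots> = n"
    using Union_orbits[OF assms] by simp
  finally have "sum_mset (cycle_type n w) = n" .
  moreover have "0 \<notin># cycle_type n w"
  proof
    assume "0 \<in># cycle_type n w"
    then obtain x where "card (orbit w x) = 0"
      by (metis imageE set_mset_cycle_type)
    then show False
      using card_orbit_pos[OF perm, of x] by simp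
  qed
  ultimately show ?thesis
    by (simp add: partitions_def)
qed

lemma cycle_type_conjugate:
  assumes u: "u permutes {1..n}"
  shows "cycle_type n (u \<circ> w \<circ> inv' u) = cycle_type n w"
proof -
  have bij: "bij u"
    using u by (rule permutes_bij)
  have "orbit (u \<circ> w \<circ> inv' u) ` {1..n} = orbit (u \<circ> w \<circ> inv' u) ` u ` {1..n}"
    unfolding permutes_image[OF u] ..
  also have "\<dots> = (`) u ` orbit w ` {1..n}"
    by (simp add: image_image orbit_conjugate[OF bij])
  finally have im: "orbit (u \<circ> w \<circ> inv' u) ` {1..n} = (`) u ` orbit w ` {1..n}" .
  have inj: "inj_on ((`) u) (orbit w ` {1..n})"
    using bij by (meson bij_is_inj inj_image_eq_iff inj_onI)
  have card: "card \<circ> (`) u = card"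
    using bij by (auto simp: fun_eq_iff bij_def intro: card_image inj_on_subset)
  show ?thesis
    unfolding cycle_type_def im image_mset_mset_set[OF inj, symmetric]
    by (simp add: multiset.map_comp card)
qed

lemma ex_bij_betw_of_image_mset_eq:
  assumes "finite A" "finite B" and eq: "image_mset f (mset_set A) = image_mset g (mset_set B)"
  shows "\<exists>h. bij_betw h A B \<and> (\<forall>x\<in>A. f x = g (h x))"
proof -
  have "card A = card B"
    using arg_cong[OF eq, of size] by simp
  then obtain h where h: "bij_betw h A B"
    using finite_same_card_bij assms(1,2) by blast
  then have "image_mset f (mset_set A) = image_mset (g \<circ> h) (mset_set A)"
    unfolding eq multiset.map_comp[symmetric] by (simp add: bij_betw_def image_mset_mset_set)
  then obtain p where "p permutes A" "\<forall>x\<in>A. f x = (g \<circ> h) (p x)"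
    using image_mset_eq_implies_permutes[OF assms(1)] by blast
  then show ?thesis
    using bij_betw_trans[OF permutes_imp_bij h, of p] by auto
qed

text \<open>The cycles of w and w' are matched by a length-preserving bijection f; u then sends the
  i-th iterate of the least point of a cycle to the i-th iterate of the least point of its
  partner.\<close>

lemma conjugate_of_cycle_type_eq:
  assumes w: "w permutes {1..n}" and w': "w' permutes {1..n}"
    and eq: "cycle_type n w = cycle_type n w'"
  obtains u where "u permutes {1..n}" and "w' = u \<circ> w \<circ> inv' u"
proof -
  have perm: "permutation w" and perm': "permutation w'"
    using w w' permutation_permutes by blast+
  obtain f where f: "bij_betw f (orbit w ` {1..n}) (orbit w' ` {1..n})"
    and card_f: "\<And>c. c \<in> orbit w ` {1..n} \<Longrightarrow> card c = card (f c)"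
    using ex_bij_betw_of_image_mset_eq[of "orbit w ` {1..n}" "orbit w' ` {1..n}" card card] eq
    unfolding cycle_type_def by blast
  define idx where "idx x = (SOME i. (w ^^ i) (Min (orbit w x)) = x)" for x
  have idx: "(w ^^ idx x) (Min (orbit w x)) = x" for x
  proof -
    have "x \<in> orbit w (Min (orbit w x))"
      using Min_orbit_in[OF perm, of x] by (simp add: in_orbit_iff perm)
    then have "\<exists>i. x = (w ^^ i) (Min (orbit w x))"
      unfolding orbit_altdef_permutation[OF perm, of "Min (orbit w x)"] by (simp only: mem_Collect_eq simp_thms)
    then have "\<exists>i. (w ^^ i) (Min (orbit w x)) = x"
      by metis
    then show ?thesis
      unfolding idx_def by (rule someI_ex)
  qed
  have orb_Min: "orbit w (Min (orbit w x)) = orbit w x" for x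
    using Min_orbit_in[OF perm] by (rule orbit_eq_permutation[OF perm])
  have f_orb: "orbit w' (Min (f (orbit w x))) = f (orbit w x)" "f (orbit w x) \<subseteq> {1..n}" if x: "x \<in> {1..n}" for x
  proof -
    have "f (orbit w x) \<in> orbit w' ` {1..n}"
      using bij_betwE[OF f] x by blast
    then obtain y where y: "y \<in> {1..n}" "f (orbit w x) = orbit w' y"
      by blast
    show "orbit w' (Min (f (orbit w x))) = f (orbit w x)"
      unfolding y(2) using Min_orbit_in[OF perm'] by (rule orbit_eq_permutation[OF perm'])
    show "f (orbit w x) \<subseteq> {1..n}"
      unfolding y(2) using permutes_orbit_subset[OF w' y(1)] .
  qed
  define u where "u x = (if x \<in> {1..n} then (w' ^^ idx x) (Min (f (orbit w x))) else x)" for x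
  have u_in: "u x \<in> f (orbit w x)" if x: "x \<in> {1..n}" for x
  proof -
    have "(w' ^^ idx x) (Min (f (orbit w x))) \<in> orbit w' (Min (f (orbit w x)))"
      by (auto simp: orbit_altdef_permutation[OF perm'])
    then show ?thesis
      using x f_orb(1)[OF x] by (simp add: u_def)
  qed
  \<comment> \<open>Equal lengths make coincidences of iterates the same on both cycles; this yields
    both injectivity of u and u w = w' u.\<close>
  have shift: "(w' ^^ i) (Min (f (orbit w x))) = (w' ^^ j) (Min (f (orbit w x)))
      \<longleftrightarrow> (w ^^ i) (Min (orbit w x)) = (w ^^ j) (Min (orbit w x))" if x: "x \<in> {1..n}" for i j x
    using card_f[of "orbit w x"] x
    by (simp add: funpow_eq_iff_cong[OF perm] funpow_eq_iff_cong[OF perm'] f_orb orb_Min)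
  have inj: "inj_on u {1..n}"
  proof (rule inj_onI)
    fix x y assume x: "x \<in> {1..n}" and y: "y \<in> {1..n}" and uxy: "u x = u y"
    have orb_u: "orbit w' (u z) = f (orbit w z)" if z: "z \<in> {1..n}" for z
      using orbit_eq_permutation[OF perm', of "u z" "Min (f (orbit w z))"] u_in[OF z]
      unfolding f_orb(1)[OF z] by blast
    have "f (orbit w x) = f (orbit w y)"
      unfolding orb_u[OF x, symmetric] orb_u[OF y, symmetric] uxy ..
    then have orb: "orbit w x = orbit w y"
      by (rule inj_onD[OF bij_betw_imp_inj_on[OF f] _ imageI[OF x] imageI[OF y]])
    have "(w' ^^ idx x) (Min (f (orbit w x))) = (w' ^^ idx y) (Min (f (orbit w x)))"
      using uxy x y unfolding u_def orb by (simp only: if_True)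
    then have "(w ^^ idx x) (Min (orbit w x)) = (w ^^ idx y) (Min (orbit w x))"
      unfolding shift[OF x] .
    then show "x = y"
      unfolding idx using idx[of y] unfolding orb by (rule trans)
  qed
  have u: "u permutes {1..n}"
  proof (rule inj_imp_permutes[OF inj])
    show "u x \<in> {1..n}" if "x \<in> {1..n}" for x
      using u_in[OF that] f_orb(2)[OF that] by (rule subsetD[rotated])
    show "u x = x" if "x \<notin> {1..n}" for x
      using that unfolding u_def by (simp only: if_False)
  qed simp
  have "u (w x) = w' (u x)" for x
  proof (cases "x \<in> {1..n}")
    case True
    then have wx: "w x \<in> {1..n}"
      using permutes_in_image[OF w] by blast
    have orb: "orbit w (w x) = orbit w x"
      by (rule orbit_apply_permutation[OF perm])
    \<comment> \<open>The chosen index of w x need not be the successor of that of x; only the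
      points they name agree.\<close>
    have "(w ^^ idx (w x)) (Min (orbit w x)) = (w ^^ Suc (idx x)) (Min (orbit w x))"
      using idx[of "w x"] idx[of x] by (simp add: orb)
    then have "(w' ^^ idx (w x)) (Min (f (orbit w x))) = (w' ^^ Suc (idx x)) (Min (f (orbit w x)))"
      using shift[OF True] by blast
    then show ?thesis
      using True wx by (simp add: u_def orb)
  next
    case False
    then have "w x \<notin> {1..n}" "w x = x" "w' x = x"
      using permutes_not_in[OF w] permutes_not_in[OF w'] by simp_all
    then show ?thesis
      unfolding u_def using False by (simp only: if_False)
  qed
  then have "u \<circ> w = w' \<circ> u"
    by auto
  then have "u \<circ> w \<circ> inv' u = w' \<circ> (u \<circ> inv' u)"
    by (simp add: comp_assoc)
  then have "w' = u \<circ> w \<circ> inv' u"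
    using permutes_inv_o(1)[OF u] by simp
  with u show thesis
    using that by blast
qed

text \<open>Induction on the multiset: a part k is realized by one new cycle on the k points above
  those already used.\<close>

lemma ex_cycle_type:
  assumes "\<mu> \<in> partitions n"
  obtains w where "w permutes {1..n}" "cycle_type n w = \<mu>"
  using assms
proof (induction \<mu> arbitrary: n thesis)
  case empty
  then show ?case
    by (auto simp: partitions_def cycle_type_def intro!: empty(1)[of id])
next
  case (add k \<mu>)
  define l where "l = sum_mset \<mu>"
  have k: "k > 0" and n: "n = l + k" and \<mu>: "\<mu> \<in> partitions l"
    using add.prems(2) by (auto simp: partitions_def l_def)
  obtain v where v: "v permutes {1..l}" and tv: "cycle_type l v = \<mu>"
    using add.IH \<mu> by blast
  have perm_v: "permutation v"
    using v permutation_permutes by blast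
  \<comment> \<open>The new cycle runs from \<open>Suc l\<close> up to n and wraps around; for k = 1
    it is a fixed point.\<close>
  define w where "w x = (if x \<le> l then v x else if x < n then Suc x else if x = n then Suc l else x)" for x
  have v_le: "v x \<le> l \<longleftrightarrow> x \<le> l" for x
    using permutes_in_image[OF v, of x] permutes_not_in[OF v, of 0] permutes_not_in[OF v, of x] by (cases "x = 0") auto
  have inj_v: "v x = v y \<longleftrightarrow> x = y" for x y
    using permutes_inj[OF v] by (auto dest: injD)
  have w: "w permutes {1..n}"
  proof (rule inj_imp_permutes)
    show "inj_on w {1..n}"
      by (rule inj_onI) (use v_le inj_v in \<open>auto simp: w_def split: if_splits\<close>, (metis Suc_leD not_less_eq_eq)+)
    show "w x \<in> {1..n}" if "x \<in> {1..n}" for x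
      using that n v_le[of x] permutes_in_image[OF v, of x] by (auto simp: w_def)
    show "w x = x" if "x \<notin> {1..n}" for x
      using that n k permutes_not_in[OF v, of x] by (auto simp: w_def)
  qed simp
  have perm_w: "permutation w"
    using w permutation_permutes by blast
  have low: "orbit w x = orbit v x" if "x \<le> l" for x
  proof -
    have "(v ^^ i) x \<le> l" for i
      using that by (induction i) (simp_all add: v_le)
    then have "(w ^^ i) x = (v ^^ i) x" for i
      by (induction i) (simp_all add: w_def)
    then show ?thesis
      by (simp add: orbit_altdef)
  qed
  have high0: "orbit w (Suc l) = {Suc l..n}"
  proof
    show "orbit w (Suc l) \<subseteq> {Suc l..n}"
      using n k by (intro orbit_subset_closed) (auto simp: w_def)
    have "(w ^^ i) (Suc l) = Suc l + i" if "i < k" for i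
      using that by (induction i) (auto simp: w_def n)
    then show "{Suc l..n} \<subseteq> orbit w (Suc l)"
    proof (intro subsetI)
      fix x assume *: "\<And>i. i < k \<Longrightarrow> (w ^^ i) (Suc l) = Suc l + i" and x: "x \<in> {Suc l..n}"
      have "(w ^^ (x - Suc l)) (Suc l) = x"
        using x n *[of "x - Suc l"] by auto
      then show "x \<in> orbit w (Suc l)"
        unfolding orbit_altdef_permutation[OF perm_w] by (metis (mono_tags) mem_Collect_eq)
    qed
  qed
  have high: "orbit w x = {Suc l..n}" if "x \<in> {Suc l..n}" for x
    using that orbit_eq_permutation[OF perm_w, of x "Suc l"] high0 by simp
  have "orbit w ` {1..l} = orbit v ` {1..l}"
    by (intro image_cong refl low) simp
  moreover have "orbit w ` {Suc l..n} = {{Suc l..n}}"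
  proof -
    have "orbit w ` {Suc l..n} = (\<lambda>_. {Suc l..n}) ` {Suc l..n}"
      by (rule image_cong[OF refl high])
    then show ?thesis
      using n k by (simp add: image_constant_conv)
  qed
  moreover have "{1..n} = {1..l} \<union> {Suc l..n}"
    using n by auto
  ultimately have im: "orbit w ` {1..n} = insert {Suc l..n} (orbit v ` {1..l})"
    by (simp add: image_Un)
  have "{Suc l..n} \<notin> orbit v ` {1..l}"
  proof
    assume "{Suc l..n} \<in> orbit v ` {1..l}"
    then have "{Suc l..n} \<subseteq> {1..l}"
      using permutes_orbit_subset[OF v] by (metis imageE)
    then have "Suc l \<in> {1..l}"
      using n k by (auto simp: subset_iff)
    then show False
      by simp
  qed
  then have "cycle_type n w = add_mset (card {Suc l..n}) (cycle_type l v)"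
    unfolding cycle_type_def im by simp
  then have "cycle_type n w = add_mset k \<mu>"
    using n by (simp add: tv)
  then show ?case
    using add.prems(1) w by blast
qed

section \<open>Counting a conjugacy class by centralizers\<close>

context coprime_split
begin

text \<open>The permutations conjugating w to u w u^-1 form a coset of the centralizer of the
  latter, with u as one member.\<close>

lemma centralizer_transport:
  assumes w: "w \<in> perms" and u: "u \<in> perms"
  shows "card {v \<in> perms. v \<circ> w \<circ> inv' v = u \<circ> w \<circ> inv' u} = card (centralizer (u \<circ> w \<circ> inv' u))"
proof (rule bij_betw_same_card[of "\<lambda>v. v \<circ> inv' u"], rule bij_betw_byWitness[where f' = "\<lambda>g. g \<circ> u"])
  have inv: "inv' p \<circ> p = id" "p \<circ> inv' p = id" if "p \<in> perms" for p
    using that permutes_inv_o[of p "{1..n}"] by auto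
  have invu: "inv' u \<in> perms"
    using u by (simp add: permutes_inv)
  let ?w' = "u \<circ> w \<circ> inv' u"
  show "\<forall>v\<in>{v \<in> perms. v \<circ> w \<circ> inv' v = ?w'}. v \<circ> inv' u \<circ> u = v"
    by (simp add: comp_assoc inv[OF u])
  show "\<forall>g\<in>centralizer ?w'. g \<circ> u \<circ> inv' u = g"
    by (simp add: comp_assoc inv[OF u])
  have eq: "v \<circ> w \<circ> inv' v = ?w' \<longleftrightarrow> (v \<circ> inv' u) \<circ> ?w' = ?w' \<circ> (v \<circ> inv' u)" if v: "v \<in> perms" for v
  proof -
    have l: "(v \<circ> inv' u) \<circ> ?w' = v \<circ> w \<circ> inv' v \<circ> (v \<circ> inv' u)"
      using inv[OF v] inv[OF u] by (auto simp: fun_eq_iff)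
    have "p = q \<longleftrightarrow> p \<circ> (v \<circ> inv' u) = q \<circ> (v \<circ> inv' u)" for p q :: "nat \<Rightarrow> nat"
    proof
      assume "p \<circ> (v \<circ> inv' u) = q \<circ> (v \<circ> inv' u)"
      then have "p \<circ> (v \<circ> inv' u) \<circ> (u \<circ> inv' v) = q \<circ> (v \<circ> inv' u) \<circ> (u \<circ> inv' v)"
        by simp
      moreover have "(v \<circ> inv' u) \<circ> (u \<circ> inv' v) = id"
        using inv[OF v] inv[OF u] by (auto simp: fun_eq_iff)
      ultimately show "p = q"
        by (simp add: comp_assoc)
    qed simp
    from this[of "v \<circ> w \<circ> inv' v" ?w'] show ?thesis
      unfolding l .
  qed
  show "(\<lambda>v. v \<circ> inv' u) ` {v \<in> perms. v \<circ> w \<circ> inv' v = ?w'} \<subseteq> centralizer ?w'"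
    using eq invu by (auto simp: centralizer_def permutes_compose)
  show "(\<lambda>g. g \<circ> u) ` centralizer ?w' \<subseteq> {v \<in> perms. v \<circ> w \<circ> inv' v = ?w'}"
  proof
    fix v assume "v \<in> (\<lambda>g. g \<circ> u) ` centralizer ?w'"
    then obtain g where g: "g \<in> perms" "g \<circ> ?w' = ?w' \<circ> g" "v = g \<circ> u"
      by (auto simp: centralizer_def)
    have v: "v \<in> perms"
      using g u by (auto intro: permutes_compose)
    have "v \<circ> inv' u = g"
      by (simp add: g(3) comp_assoc inv[OF u])
    then show "v \<in> {v \<in> perms. v \<circ> w \<circ> inv' v = ?w'}"
      using v eq[OF v] g(2) by simp
  qed
qed

text \<open>Conjugating a fixed \<open>w0\<close> maps S_n onto the class, and the fibre over w has
  the size of the centralizer of w; the fibres partition S_n.\<close>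

lemma sum_card_centralizer:
  assumes "\<mu> \<in> partitions n"
  shows "(\<Sum>w | w \<in> perms \<and> cycle_type n w = \<mu>. card (centralizer w)) = fact n"
proof -
  obtain w0 where w0: "w0 permutes {1..n}" "cycle_type n w0 = \<mu>"
    using ex_cycle_type[OF assms] .
  define f :: "(nat \<Rightarrow> nat) \<Rightarrow> nat \<Rightarrow> nat" where "f u = u \<circ> w0 \<circ> inv' u" for u
  have fin: "finite perms"
    by (simp add: finite_permutations)
  have im: "f ` perms = {w \<in> perms. cycle_type n w = \<mu>}"
  proof
    show "f ` perms \<subseteq> {w \<in> perms. cycle_type n w = \<mu>}"
      using w0 by (auto simp: f_def cycle_type_conjugate intro!: permutes_compose permutes_inv)
    show "{w \<in> perms. cycle_type n w = \<mu>} \<subseteq> f ` perms"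
    proof
      fix w assume "w \<in> {w \<in> perms. cycle_type n w = \<mu>}"
      then have "w permutes {1..n}" "cycle_type n w0 = cycle_type n w"
        using w0 by auto
      then obtain u where "u permutes {1..n}" "w = u \<circ> w0 \<circ> inv' u"
        using conjugate_of_cycle_type_eq[OF w0(1)] by blast
      then show "w \<in> f ` perms"
        by (auto simp: f_def)
    qed
  qed
  have "fact n = card perms"
    using card_permutations[of "{1..n}" n] by simp
  also have "\<dots> = (\<Sum>w\<in>f ` perms. card {u \<in> perms. f u = w})"
    using sum.image_gen[OF fin, of "\<lambda>_. 1 :: nat" f] by simp
  also have "\<dots> = (\<Sum>w\<in>f ` perms. card (centralizer w))"
    using w0 centralizer_transport[of w0] by (intro sum.cong refl) (auto simp: f_def)
  finally show ?thesis
    unfolding im by simp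
qed

end

section \<open>The twisted conjugation representation\<close>

lemma complex_repI:
  fixes G (structure)
  assumes G: "group G"
    and carr: "\<And>g. g \<in> carrier G \<Longrightarrow> \<rho> g \<in> carrier_mat d d"
    and mult: "\<And>g h. g \<in> carrier G \<Longrightarrow> h \<in> carrier G \<Longrightarrow> \<rho> (g \<otimes> h) = \<rho> g * \<rho> h"
    and one: "\<rho> \<one> = 1\<^sub>m d"
  shows "complex_rep G d \<rho>"
proof -
  interpret group G by (rule G)
  have "\<rho> g \<in> carrier (GL d)" if g: "g \<in> carrier G" for g
  proof -
    have "\<rho> g * \<rho> (inv g) = 1\<^sub>m d" "\<rho> (inv g) * \<rho> g = 1\<^sub>m d"
      using g by (simp_all add: mult[symmetric] one)
    then show ?thesis
      using carr g by (auto simp: units_of_def Units_def ring_mat_simps)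
  qed
  then show ?thesis
    using mult by (auto simp: complex_rep_def hom_def units_of_def ring_mat_simps)
qed

lemma mcoeff_mscale: "mcoeff (mscale c f) x = c * mcoeff f x"
  by transfer simp

lemma mcoeff_sum: "mcoeff (\<Sum>i\<in>I. F i) x = (\<Sum>i\<in>I. mcoeff (F i) x)"
proof (induction I rule: infinite_finite_induct)
  case (insert i I)
  then show ?case
    by (simp add: plus_mseries.rep_eq)
qed (simp_all add: zero_mseries.rep_eq)

lemma sign_funpow: "permutation w \<Longrightarrow> sign (w ^^ k) = sign w ^ k"
proof (induction k)
  case (Suc k)
  have "permutation (w ^^ k)"
    using Suc.prems by (induction k) (simp_all add: permutation_compose permutation_id[unfolded id_def] id_def)
  then show ?case
    using Suc by (simp only: funpow.simps(2) sign_compose power_Suc)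
qed (simp add: sign_id)

context coprime_split
begin

text \<open>Any numbering of S_n works; it only serves to index rows and columns by numbers.\<close>

definition enum :: "nat \<Rightarrow> nat \<Rightarrow> nat"
  where "enum = (SOME b. bij_betw b {..<fact n} perms)"

lemma bij_enum: "bij_betw enum {..<fact n} perms"
proof -
  have "card {..<fact n :: nat} = card perms"
    using card_permutations[of "{1..n}" n] by simp
  then have "\<exists>b. bij_betw b {..<fact n :: nat} perms"
    using finite_permutations[of "{1..n}"] by (intro finite_same_card_bij) simp_all
  then show ?thesis
    unfolding enum_def by (rule someI_ex)
qed

lemma enum_perms: "i < fact n \<Longrightarrow> enum i \<in> perms"
  using bij_betwE[OF bij_enum] by blast

text \<open>Column j represents the basis vector of g = \<open>enum j\<close>, which is sent to
  \<open>alpha w g\<close> times the basis vector of w g w^-1.\<close>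

definition twisted_conjugation_rep :: "(nat \<Rightarrow> nat) \<Rightarrow> complex mat"
  where "twisted_conjugation_rep w = mat (fact n) (fact n)
    (\<lambda>(i, j). if enum i = w \<circ> enum j \<circ> inv' w then alpha w (enum j) else 0)"

lemma twisted_conjugation_rep_carrier: "twisted_conjugation_rep w \<in> carrier_mat (fact n) (fact n)"
  by (simp add: twisted_conjugation_rep_def)

lemma twisted_conjugation_rep_comp:
  assumes v: "v \<in> perms" and w: "w \<in> perms"
  shows "twisted_conjugation_rep (v \<circ> w) = twisted_conjugation_rep v * twisted_conjugation_rep w"
proof (rule eq_matI)
  let ?R = twisted_conjugation_rep
  fix i j assume "i < dim_row (?R v * ?R w)" "j < dim_col (?R v * ?R w)"
  then have ij: "i < fact n" "j < fact n"
    by (simp_all add: twisted_conjugation_rep_def)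
  define h where "h = w \<circ> enum j \<circ> inv' w"
  have "h \<in> enum ` {..<fact n}"
    using perms_conjugate[OF w enum_perms[OF ij(2)]] bij_enum unfolding h_def bij_betw_def by blast
  \<comment> \<open>Each column has one nonzero entry, so a single intermediate index contributes to
    the matrix product and the rest is the cocycle identity.\<close>
  then obtain l where l: "l < fact n" "enum l = h"
    by auto
  have inj: "enum a = h \<longleftrightarrow> a = l" if "a < fact n" for a
    using that l bij_enum by (auto simp: bij_betw_def inj_on_def)
  have conj: "(v \<circ> w) \<circ> enum j \<circ> inv' (v \<circ> w) = v \<circ> h \<circ> inv' v"
    using perms_bij[OF v] perms_bij[OF w] by (simp add: h_def o_inv_distrib comp_assoc)
  have "?R w $$ (a, j) = (if a = l then alpha w (enum j) else 0)" if "a < fact n" for a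
    using that ij(2) inj[OF that] by (simp add: twisted_conjugation_rep_def h_def[symmetric])
  then have "(?R v * ?R w) $$ (i, j) = (\<Sum>a<fact n. (if a = l then ?R v $$ (i, a) * alpha w (enum j) else 0))"
    using ij by (subst index_mult_square[OF twisted_conjugation_rep_carrier twisted_conjugation_rep_carrier])
      (simp_all add: if_distrib[of "\<lambda>x. _ * x"] cong: if_cong)
  also have "\<dots> = ?R v $$ (i, l) * alpha w (enum j)"
    using l by simp
  also have "\<dots> = ?R (v \<circ> w) $$ (i, j)"
    using ij l alpha_comp[OF v w enum_perms[OF ij(2)]]
    unfolding twisted_conjugation_rep_def by (simp only: index_mat prod.case conj h_def[symmetric] l(2)) simp
  finally show "?R (v \<circ> w) $$ (i, j) = (?R v * ?R w) $$ (i, j)" ..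
qed (simp_all add: twisted_conjugation_rep_def)

lemma twisted_conjugation_rep_id: "twisted_conjugation_rep id = 1\<^sub>m (fact n)"
proof (rule eq_matI)
  fix i j assume "i < dim_row (1\<^sub>m (fact n) :: complex mat)" "j < dim_col (1\<^sub>m (fact n) :: complex mat)"
  then have ij: "i < fact n" "j < fact n"
    by simp_all
  then have "enum i = enum j \<longleftrightarrow> i = j"
    using bij_enum by (auto simp: bij_betw_def inj_on_def)
  then show "twisted_conjugation_rep id $$ (i, j) = 1\<^sub>m (fact n) $$ (i, j)"
    using ij by (simp add: twisted_conjugation_rep_def alpha_id)
qed (simp_all add: twisted_conjugation_rep_def)

lemma complex_rep_twisted_conjugation: "complex_rep (sym_group n) (fact n) twisted_conjugation_rep"
  by (rule complex_repI[OF sym_group_is_group])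
    (use twisted_conjugation_rep_comp in \<open>auto simp: sym_group_def twisted_conjugation_rep_carrier
      twisted_conjugation_rep_id\<close>)

definition splitting_type :: "nat multiset \<Rightarrow> bool"
  where "splitting_type \<mu> \<longleftrightarrow> (\<forall>i\<in>#\<mu>. i dvd M')"

lemma mat_trace_twisted_conjugation:
  assumes w: "w \<in> perms"
  shows "mat_trace (twisted_conjugation_rep w)
    = (if splitting_type (cycle_type n w) then of_nat (card (centralizer w)) else 0)"
proof -
  have comm: "g = w \<circ> g \<circ> inv' w \<longleftrightarrow> g \<circ> w = w \<circ> g" for g
  proof
    assume "g = w \<circ> g \<circ> inv' w"
    then have "g \<circ> w = w \<circ> g \<circ> (inv' w \<circ> w)"
      by (metis comp_assoc)
    then show "g \<circ> w = w \<circ> g"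
      using w permutes_inv_o(2)[of w "{1..n}"] by simp
  qed (use conjugate_eq_self[OF perms_bij[OF w]] in simp)
  have "mat_trace (twisted_conjugation_rep w)
      = (\<Sum>i<fact n. if enum i \<circ> w = w \<circ> enum i then alpha w (enum i) else 0)"
    by (simp add: mat_trace_square[OF twisted_conjugation_rep_carrier])
      (simp add: twisted_conjugation_rep_def comm cong: if_cong)
  also have "\<dots> = (\<Sum>g\<in>perms. if g \<circ> w = w \<circ> g then alpha w g else 0)"
    using bij_enum by (rule sum.reindex_bij_betw)
  also have "\<dots> = (\<Sum>g\<in>centralizer w. alpha w g)"
    unfolding centralizer_def using finite_permutations[of "{1..n}"]
    by (subst sum.inter_filter) simp_all
  also have "\<dots> = (if splitting_type (cycle_type n w) then of_nat (card (centralizer w)) else 0)"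
    using sum_alpha_eq_0[OF w] sum_alpha_eq_card[OF w]
    by (auto simp: splitting_type_def set_mset_cycle_type)
  finally show ?thesis .
qed

text \<open>Grouping permutations by cycle type, each admissible type collects the sum of its
  centralizer orders, which is n!.\<close>

lemma frobenius_char_twisted_conjugation:
  "frobenius_char n twisted_conjugation_rep
    = (\<Sum>\<mu> | \<mu> \<in> partitions n \<and> splitting_type \<mu>. power_sum_part \<mu>)"
proof (rule mseries_eqI)
  fix x
  define f where "f \<mu> = mcoeff (power_sum_part \<mu> :: complex mseries) x" for \<mu>
  have fin: "finite perms"
    by (simp add: finite_permutations)
  have "mcoeff (frobenius_char n twisted_conjugation_rep) x
      = (\<Sum>w\<in>perms. mat_trace (twisted_conjugation_rep w) * f (cycle_type n w)) / fact n"
    unfolding frobenius_char_def mcoeff_mscale mcoeff_sum f_def by (simp add: sym_group_def)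
  also have "(\<Sum>w\<in>perms. mat_trace (twisted_conjugation_rep w) * f (cycle_type n w))
      = (\<Sum>\<mu>\<in>partitions n. \<Sum>w | w \<in> perms \<and> cycle_type n w = \<mu>.
          mat_trace (twisted_conjugation_rep w) * f (cycle_type n w))"
    using fin finite_partitions cycle_type_in_partitions
    by (intro sum.group[symmetric]) auto
  also have "\<dots> = (\<Sum>\<mu>\<in>partitions n. fact n * (if splitting_type \<mu> then f \<mu> else 0))"
  proof (rule sum.cong[OF refl])
    fix \<mu> assume \<mu>: "\<mu> \<in> partitions n"
    have "(\<Sum>w | w \<in> perms \<and> cycle_type n w = \<mu>. mat_trace (twisted_conjugation_rep w) * f (cycle_type n w))
        = (\<Sum>w | w \<in> perms \<and> cycle_type n w = \<mu>. of_nat (card (centralizer w)) * (if splitting_type \<mu> then f \<mu> else 0))"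
      by (rule sum.cong[OF refl]) (auto simp: mat_trace_twisted_conjugation)
    also have "\<dots> = of_nat (fact n) * (if splitting_type \<mu> then f \<mu> else 0)"
      unfolding sum_card_centralizer[OF \<mu>, symmetric] by (simp add: sum_distrib_right)
    finally show "(\<Sum>w | w \<in> perms \<and> cycle_type n w = \<mu>. mat_trace (twisted_conjugation_rep w) * f (cycle_type n w))
        = fact n * (if splitting_type \<mu> then f \<mu> else 0)"
      by simp
  qed
  also have "\<dots> / fact n = (\<Sum>\<mu>\<in>partitions n. if splitting_type \<mu> then f \<mu> else 0)"
    by (simp add: sum_distrib_left[symmetric])
  also have "\<dots> = (\<Sum>\<mu> | \<mu> \<in> partitions n \<and> splitting_type \<mu>. f \<mu>)"
    using finite_partitions by (subst sum.inter_filter) simp_all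
  also have "\<dots> = mcoeff (\<Sum>\<mu> | \<mu> \<in> partitions n \<and> splitting_type \<mu>. power_sum_part \<mu>) x"
    by (simp add: f_def mcoeff_sum)
  finally show "mcoeff (frobenius_char n twisted_conjugation_rep) x
    = mcoeff (\<Sum>\<mu> | \<mu> \<in> partitions n \<and> splitting_type \<mu>. power_sum_part \<mu>) x" .
qed

lemma self_conjugate_twisted_conjugation:
  assumes "odd M'"
  shows "self_conjugate n (fact n) twisted_conjugation_rep"
  unfolding self_conjugate_def
proof (rule isomorphic_reps_of_mat_trace_eq[OF sym_group_is_group _ complex_rep_twisted_conjugation])
  let ?R = twisted_conjugation_rep
  show "finite (carrier (sym_group n))"
    by (simp add: sym_group_def finite_permutations)
  show "complex_rep (sym_group n) (fact n) (sign_twist ?R)"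
  proof (rule complex_repI[OF sym_group_is_group])
    show "sign_twist ?R g \<in> carrier_mat (fact n) (fact n)" for g
      by (simp add: sign_twist_def twisted_conjugation_rep_carrier)
    show "sign_twist ?R (g \<otimes>\<^bsub>sym_group n\<^esub> h) = sign_twist ?R g * sign_twist ?R h"
      if "g \<in> carrier (sym_group n)" "h \<in> carrier (sym_group n)" for g h
      using that twisted_conjugation_rep_comp[of g h] sign_compose[of g h]
        mult_smult_distrib[OF twisted_conjugation_rep_carrier twisted_conjugation_rep_carrier]
        mult_smult_assoc_mat[OF twisted_conjugation_rep_carrier, of _ "fact n"]
      by (intro eq_matI) (simp_all add: sign_twist_def sym_group_mult sym_group_carrier sym_group_carrier'
          twisted_conjugation_rep_carrier mult.commute)
    show "sign_twist ?R \<one>\<^bsub>sym_group n\<^esub> = 1\<^sub>m (fact n)"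
      by (intro eq_matI) (simp_all add: sign_twist_def sym_group_one twisted_conjugation_rep_id sign_id)
  qed
  fix w assume "w \<in> carrier (sym_group n)"
  then have w: "w \<in> perms"
    by (simp add: sym_group_def)
  have tr: "mat_trace (sign_twist ?R w) = of_int (sign w) * mat_trace (?R w)"
    by (simp add: sign_twist_def mat_trace_def sum_distrib_left twisted_conjugation_rep_def)
  show "mat_trace (?R w) = mat_trace (sign_twist ?R w)"
  proof (cases "splitting_type (cycle_type n w)")
    case True
    \<comment> \<open>Where the trace is nonzero, w has odd order and therefore sign 1.\<close>
    then have "w ^^ M' = id"
      using funpow_eq_id_of_dvd[OF w] by (auto simp: splitting_type_def set_mset_cycle_type)
    then have "sign w ^ M' = 1"
      using sign_funpow[OF perms_permutation[OF w], of M'] by (simp add: sign_id)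
    then have "sign w = 1"
      using assms by (cases w rule: sign_cases) auto
    then show ?thesis
      by (simp add: tr)
  qed (use mat_trace_twisted_conjugation[OF w] in \<open>simp add: tr\<close>)
qed

end

section \<open>The three factorizations of n!\<close>

text \<open>Parts of a partition of n are at most n and so divide n!; the divisibility condition has
  to be translated into \<open>P\<close> only for such numbers.\<close>

lemma ex_rep_of_coprime_split:
  assumes "fact n = M * M'" "coprime M M'"
    and P: "\<And>i. 0 < i \<Longrightarrow> i \<le> n \<Longrightarrow> i dvd M * M' \<Longrightarrow> i dvd M' \<longleftrightarrow> P i"
  shows "\<exists>\<rho>. complex_rep (sym_group n) (fact n) \<rho> \<and>
    frobenius_char n \<rho> = (\<Sum>\<mu> | \<mu> \<in> partitions n \<and> (\<forall>i\<in>#\<mu>. P i). power_sum_part \<mu>) \<and>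
    (odd M' \<longrightarrow> self_conjugate n (fact n) \<rho>)"
proof -
  interpret coprime_split n M M'
    using assms by unfold_locales
  have "i dvd M' \<longleftrightarrow> P i" if "\<mu> \<in> partitions n" "i \<in># \<mu>" for \<mu> i
  proof -
    have "0 < i" "i \<le> n"
      using that by (auto simp: partitions_def dest: multi_member_split intro: gr0I)
    moreover have "i dvd fact n"
      using calculation by (intro dvd_fact) auto
    ultimately show ?thesis
      by (intro P) (simp_all add: fact_eq)
  qed
  then have "{\<mu> \<in> partitions n. splitting_type \<mu>} = {\<mu> \<in> partitions n. \<forall>i\<in>#\<mu>. P i}"
    by (auto simp: splitting_type_def)
  then show ?thesis
    using complex_rep_twisted_conjugation frobenius_char_twisted_conjugation
      self_conjugate_twisted_conjugation by auto
qed

theorem theorem3p12: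
  fixes q n :: nat
  assumes "prime q" and "n \<ge> 1"
  shows
    "(\<exists>\<rho>. complex_rep (sym_group n) (fact n) \<rho> \<and>
        frobenius_char n \<rho> =
          (\<Sum>\<mu> | \<mu> \<in> partitions n \<and> (\<forall>i\<in>#\<mu>. \<exists>k. i = q ^ k). power_sum_part \<mu>) \<and>
        (odd q \<longrightarrow> self_conjugate n (fact n) \<rho>)) \<and>
     (\<exists>\<rho>. complex_rep (sym_group n) (fact n) \<rho> \<and>
        frobenius_char n \<rho> =
          (\<Sum>\<mu> | \<mu> \<in> partitions n \<and> (\<forall>i\<in>#\<mu>. gcd i q = 1). power_sum_part \<mu>)) \<and>
     (odd q \<longrightarrow>
       (\<exists>\<rho>. complex_rep (sym_group n) (fact n) \<rho> \<and>
          frobenius_char n \<rho> =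
            (\<Sum>\<mu> | \<mu> \<in> partitions n \<and> (\<forall>i\<in>#\<mu>. odd i \<and> gcd i q = 1). power_sum_part \<mu>)))"
proof -
  have q: "prime q"
    by (rule assms(1))
  have decomp: "\<exists>v r. N = p ^ v * r \<and> coprime p r" if "prime p" "N > 0" for p N :: nat
  proof -
    have "N \<noteq> 0" "\<not> is_unit p"
      using that not_prime_unit by auto
    then obtain r where "N = p ^ multiplicity p N * r" "\<not> p dvd r"
      by (rule multiplicity_decompose')
    then show ?thesis
      using prime_imp_coprime[OF that(1)] by blast
  qed
  obtain v r where r: "fact n = q ^ v * r" and qr: "coprime q r"
    using decomp[OF q, of "fact n"] by auto
  have *: "i dvd b \<longleftrightarrow> coprime i a" if i: "i dvd a * b" and ab: "coprime a b" for i a b :: nat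
  proof
    assume "i dvd b"
    then show "coprime i a"
      using ab coprime_divisors[of i b a a] coprime_commute
      by (metis dvd_refl)
  next
    assume "coprime i a"
    then show "i dvd b"
      using i by (simp add: coprime_dvd_mult_right_iff)
  qed
  \<comment> \<open>A power of q dividing n! is coprime to \<open>r\<close>, hence divides the
    q-part.\<close>
  have 1: "i dvd q ^ v \<longleftrightarrow> (\<exists>k. i = q ^ k)" if "i dvd r * q ^ v" for i
  proof
    show "\<exists>k. i = q ^ k" if "i dvd q ^ v"
      using that q by (auto simp: divides_primepow_nat)
    assume "\<exists>k. i = q ^ k"
    then have "coprime i r"
      using qr by auto
    then show "i dvd q ^ v"
      using that by (simp add: coprime_dvd_mult_right_iff)
  qed
  have 2: "i dvd r \<longleftrightarrow> gcd i q = 1" if "i dvd q ^ v * r" for i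
  proof (cases "v = 0")
    \<comment> \<open>Here coprimality to \<open>q ^ v\<close> = 1 carries no information; both
      sides hold since i divides \<open>r\<close>, which is coprime to q.\<close>
    case True
    then show ?thesis
      using that qr by (metis coprime_commute coprime_divisors coprime_iff_gcd_eq_1 dvd_refl mult_1 power_0)
  next
    case False
    then show ?thesis
      using *[OF that] qr unfolding coprime_iff_gcd_eq_1[symmetric] by simp
  qed
  have "r > 0"
    using r by (metis fact_nonzero gr0I mult_0_right)
  \<comment> \<open>Removing the powers of 2 leaves in \<open>s\<close> the largest divisor of n!
    prime to 2q.\<close>
  then obtain a s where s: "r = 2 ^ a * s" and s2: "coprime 2 s"
    using decomp[OF two_is_prime_nat, of r] by auto
  have 3: "i dvd s \<longleftrightarrow> odd i \<and> gcd i q = 1" if i: "i dvd (q ^ v * 2 ^ a) * s" for i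
  proof
    assume "i dvd s"
    then show "odd i \<and> gcd i q = 1"
      using s s2 qr by (metis coprime_commute coprime_divisors coprime_iff_gcd_eq_1 coprime_right_2_iff_odd
          dvd_mult dvd_refl)
  next
    assume "odd i \<and> gcd i q = 1"
    then have "coprime i (q ^ v * 2 ^ a)"
      unfolding coprime_iff_gcd_eq_1[symmetric] by (simp add: coprime_right_2_iff_odd)
    then show "i dvd s"
      using i by (simp add: coprime_dvd_mult_right_iff)
  qed
  \<comment> \<open>The three choices of \<open>M'\<close> are \<open>q ^ v\<close>,
    \<open>r\<close> and \<open>s\<close>. The first is odd when q is odd, which gives the
    self-conjugacy.\<close>
  have "\<exists>\<rho>. complex_rep (sym_group n) (fact n) \<rho> \<and>
      frobenius_char n \<rho> = (\<Sum>\<mu> | \<mu> \<in> partitions n \<and> (\<forall>i\<in>#\<mu>. \<exists>k. i = q ^ k). power_sum_part \<mu>) \<and>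
      (odd (q ^ v) \<longrightarrow> self_conjugate n (fact n) \<rho>)"
    using r qr 1 by (intro ex_rep_of_coprime_split[of _ r]) (simp_all add: coprime_commute mult.commute)
  moreover have "\<exists>\<rho>. complex_rep (sym_group n) (fact n) \<rho> \<and>
      frobenius_char n \<rho> = (\<Sum>\<mu> | \<mu> \<in> partitions n \<and> (\<forall>i\<in>#\<mu>. gcd i q = 1). power_sum_part \<mu>) \<and>
      (odd r \<longrightarrow> self_conjugate n (fact n) \<rho>)"
    using r qr 2 by (intro ex_rep_of_coprime_split[of _ "q ^ v"]) simp_all
  moreover have "\<exists>\<rho>. complex_rep (sym_group n) (fact n) \<rho> \<and>
      frobenius_char n \<rho> = (\<Sum>\<mu> | \<mu> \<in> partitions n \<and> (\<forall>i\<in>#\<mu>. odd i \<and> gcd i q = 1). power_sum_part \<mu>) \<and>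
      (odd s \<longrightarrow> self_conjugate n (fact n) \<rho>)"
    using r qr s s2 3 by (intro ex_rep_of_coprime_split[of _ "q ^ v * 2 ^ a"]) simp_all
  ultimately show ?thesis
    by auto
qed

end
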